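(* Let $G$ be a nilpotent group with $\mathcal{V}_\omega(\mathbb{Z}G)=\{1\}$, and let $T$ be its torsion subgroup. Then one of the following statements holds: (i) $T=\{1\}$; (ii) $T$ is a $(2,3)$-group of exponent $6$; (iii) for some prime $p$, $T$ is a $p$-group, $T(p)\neq T$, and $T(p)$ is an abelian $p$-group of exponent at most $4$. In particular, if $G$ is a nilpotent group whose torsion subgroup $T$ is $\{2,3\}$-torsion-free, then $\mathcal{V}_\omega(\mathbb{Z}G)=\{1\}$ only if either $G$ is torsion-free or, for some prime $p$, $T$ is a $p$-group which has no element of infinite $p$-height.
   Context: For a group $G$, $\mathbb{Z}G$ is the integral group ring, $\Delta(G)$ is its augmentation ideal, and $\Delta^n(G)$ is the $n$-th power of this ideal. $\mathcal{V}(\mathbb{Z}G)$ is the group of units of augmentation one in $\mathbb{Z}G$; for $n\ge 1$, $\mathcal{V}_n(\mathbb{Z}G)=\mathcal{V}(\mathbb{Z}G)\cap(1+\Delta^n(G))$; and $\mathcal{V}_\omega(\mathbb{Z}G)=\bigcap_{n=1}^\infty\mathcal{V}_n(\mathbb{Z}G)$. The torsion subgroup of a nilpotent group is the subgroup of all its elements of finite order. A (possibly infinite) group is a $p$-group if every element has order a power of $p$, and a $(2,3)$-group if every element has order of the form $2^a3^b$. A group is $\{2,3\}$-torsion-free if it has no element of order $2$ or $3$. Let $\{\gamma_j(H)\}_{j\ge1}$ be the lower central series of a group $H$. An element $g\in H$ has infinite $p$-height in $H$ if for all natural numbers $i,j$ there exist $x\in H$ and $y\in\gamma_j(H)$ with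 $x^{p^i}=gy$; the set of such elements is a normal subgroup of $H$, denoted $H(p)$. Thus $T(p)$ is the subgroup of elements of $T$ of infinite $p$-height in $T$. The phrase "$T$ has no element of infinite $p$-height" means that no non-identity element of $T$ has infinite $p$-height in $T$, i.e. $T(p)=\{1\}$. *)

theory Defs
  imports "HOL-Algebra.Algebra" "HOL-Computational_Algebra.Primes"
begin

section \<open>Integral group rings\<close>

text \<open>Elements are finitely supported integer functions with support in the carrier, the type also
  used for free abelian groups in HOL-Algebra; multiplication is the bilinear extension of the
  multiplication of \<open>G\<close>.\<close>

definition group_ring :: "('a, 'm) monoid_scheme \<Rightarrow> ('a \<Rightarrow>\<^sub>0 int) ring"
  where "group_ring G =
    \<lparr>carrier = {f. Poly_Mapping.keys f \<subseteq> carrier G},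
     monoid.mult = (\<lambda>f g. frag_extend (\<lambda>x. frag_extend (\<lambda>y. frag_of (x \<otimes>\<^bsub>G\<^esub> y)) g) f),
     one = frag_of \<one>\<^bsub>G\<^esub>,
     ring.zero = 0,
     ring.add = (+)\<rparr>"

definition augmentation :: "('a \<Rightarrow>\<^sub>0 int) \<Rightarrow> int"
  where "augmentation f = (\<Sum>x\<in>Poly_Mapping.keys f. Poly_Mapping.lookup f x)"

definition aug_ideal :: "('a, 'm) monoid_scheme \<Rightarrow> ('a \<Rightarrow>\<^sub>0 int) set"
  where "aug_ideal G = {f \<in> carrier (group_ring G). augmentation f = 0}"

fun ideal_power :: "('r, 'm) ring_scheme \<Rightarrow> 'r set \<Rightarrow> nat \<Rightarrow> 'r set"
  where
    "ideal_power R I 0 = carrier R"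
  | "ideal_power R I (Suc n) = ideal_prod R (ideal_power R I n) I"

definition normalized_units :: "('a, 'm) monoid_scheme \<Rightarrow> ('a \<Rightarrow>\<^sub>0 int) set"
  where "normalized_units G = {u \<in> Units (group_ring G). augmentation u = 1}"

definition units_level :: "('a, 'm) monoid_scheme \<Rightarrow> nat \<Rightarrow> ('a \<Rightarrow>\<^sub>0 int) set"
  where "units_level G n = normalized_units G \<inter>
    (\<one>\<^bsub>group_ring G\<^esub> <+\<^bsub>group_ring G\<^esub> ideal_power (group_ring G) (aug_ideal G) n)"

definition units_omega :: "('a, 'm) monoid_scheme \<Rightarrow> ('a \<Rightarrow>\<^sub>0 int) set"
  where "units_omega G = (\<Inter>n\<in>{1..}. units_level G n)"

lemma frag_extend_fun_add:
  "frag_extend (\<lambda>x. f x + g x) c = frag_extend f c + frag_extend g c"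
  by (simp add: frag_extend_def frag_cmul_distrib2 sum.distrib)

lemma frag_extend_fun_diff:
  "frag_extend (\<lambda>x. f x - g x) c = frag_extend f c - frag_extend g c"
  using frag_extend_fun_add[of "\<lambda>x. f x - g x" g c] by simp

lemma augmentation_diff: "augmentation (f - g) = augmentation f - augmentation g"
proof -
  have aug: "augmentation h = Poly_Mapping.lookup (frag_extend (\<lambda>_. frag_of ()) h) ()" for h :: "'a \<Rightarrow>\<^sub>0 int"
    by (simp add: augmentation_def frag_extend_def lookup_sum)
  show ?thesis
    by (simp add: aug frag_extend_diff lookup_minus)
qed

lemma augmentation_frag_of [simp]: "augmentation (frag_of x) = 1"
  by (simp add: augmentation_def)

lemma augmentation_zero [simp]: "augmentation 0 = 0"
  by (simp add: augmentation_def)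

lemma augmentation_add: "augmentation (f + g) = augmentation f + augmentation g"
  using augmentation_diff[of "f + g" g] by simp

lemma augmentation_mult:
  "augmentation (f \<otimes>\<^bsub>group_ring G\<^esub> g) = augmentation f * augmentation g"
proof -
  have 1: "augmentation (frag_extend (\<lambda>y. frag_of (h y)) g) = augmentation g" for h :: "'a \<Rightarrow> 'a"
    using subset_UNIV[of "Poly_Mapping.keys g"]
    by (induction g rule: frag_induction) (auto simp: frag_extend_diff augmentation_diff)
  show ?thesis
    unfolding group_ring_def using subset_UNIV[of "Poly_Mapping.keys f"]
    by (induction f rule: frag_induction)
       (auto simp: frag_extend_diff augmentation_diff 1 left_diff_distrib)
qed

context group
begin

lemma group_ring_mult_closed:
  assumes "Poly_Mapping.keys f \<subseteq> carrier G" "Poly_Mapping.keys g \<subseteq> carrier G"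
  shows "Poly_Mapping.keys (f \<otimes>\<^bsub>group_ring G\<^esub> g) \<subseteq> carrier G"
proof
  fix z assume "z \<in> Poly_Mapping.keys (f \<otimes>\<^bsub>group_ring G\<^esub> g)"
  then obtain x where x: "x \<in> Poly_Mapping.keys f"
    "z \<in> Poly_Mapping.keys (frag_extend (\<lambda>y. frag_of (x \<otimes> y)) g)"
    using keys_frag_extend by (fastforce simp: group_ring_def)
  then obtain y where "y \<in> Poly_Mapping.keys g" "z = x \<otimes> y"
    using keys_frag_extend by fastforce
  then show "z \<in> carrier G"
    using assms x by auto
qed

lemma group_ring_mult_assoc:
  assumes "Poly_Mapping.keys f \<subseteq> carrier G" "Poly_Mapping.keys g \<subseteq> carrier G"
    "Poly_Mapping.keys h \<subseteq> carrier G"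
  shows "(f \<otimes>\<^bsub>group_ring G\<^esub> g) \<otimes>\<^bsub>group_ring G\<^esub> h =
    f \<otimes>\<^bsub>group_ring G\<^esub> (g \<otimes>\<^bsub>group_ring G\<^esub> h)"
proof -
  have 1: "(frag_of x \<otimes>\<^bsub>group_ring G\<^esub> frag_of y) \<otimes>\<^bsub>group_ring G\<^esub> h =
      frag_of x \<otimes>\<^bsub>group_ring G\<^esub> (frag_of y \<otimes>\<^bsub>group_ring G\<^esub> h)"
    if "x \<in> carrier G" "y \<in> carrier G" for x y
    using assms(3) that
    by (induction h rule: frag_induction)
       (auto simp: group_ring_def frag_extend_diff m_assoc)
  have 2: "(frag_of x \<otimes>\<^bsub>group_ring G\<^esub> g) \<otimes>\<^bsub>group_ring G\<^esub> h =
      frag_of x \<otimes>\<^bsub>group_ring G\<^esub> (g \<otimes>\<^bsub>group_ring G\<^esub> h)"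
    if "x \<in> carrier G" for x
    using assms(2)
  proof (induction g rule: frag_induction)
    case (one y) then show ?case using 1[OF that] by simp
  qed (auto simp: group_ring_def frag_extend_diff)
  show ?thesis
    using assms(1)
  proof (induction f rule: frag_induction)
    case (one x) then show ?case using 2 by simp
  qed (auto simp: group_ring_def frag_extend_diff)
qed

lemma ring_group_ring: "ring (group_ring G)"
proof (rule ringI)
  show "abelian_group (group_ring G)"
  proof (rule abelian_groupI)
    fix f assume "f \<in> carrier (group_ring G)"
    then show "\<exists>g\<in>carrier (group_ring G). g \<oplus>\<^bsub>group_ring G\<^esub> f = \<zero>\<^bsub>group_ring G\<^esub>"
      by (intro bexI[of _ "- f"]) (auto simp: group_ring_def)
  qed (use keys_add in \<open>fastforce simp: group_ring_def add_ac\<close>)+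
next
  show "monoid (group_ring G)"
  proof (rule monoidI)
    fix f assume f: "f \<in> carrier (group_ring G)"
    have "frag_extend (\<lambda>y. frag_of (\<one> \<otimes> y)) f = f"
      by (metis (no_types, lifting) f frag_expansion frag_extend_eq group_ring_def l_one
          mem_Collect_eq partial_object.select_convs(1) subsetD)
    then show "\<one>\<^bsub>group_ring G\<^esub> \<otimes>\<^bsub>group_ring G\<^esub> f = f"
      by (simp add: group_ring_def)
    have "frag_extend (\<lambda>x. frag_of (x \<otimes> \<one>)) f = f"
      by (metis (no_types, lifting) f frag_expansion frag_extend_eq group_ring_def r_one
          mem_Collect_eq partial_object.select_convs(1) subsetD)
    then show "f \<otimes>\<^bsub>group_ring G\<^esub> \<one>\<^bsub>group_ring G\<^esub> = f"
      by (simp add: group_ring_def)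
  next
    fix f g h
    assume "f \<in> carrier (group_ring G)" "g \<in> carrier (group_ring G)" "h \<in> carrier (group_ring G)"
    then show "(f \<otimes>\<^bsub>group_ring G\<^esub> g) \<otimes>\<^bsub>group_ring G\<^esub> h =
        f \<otimes>\<^bsub>group_ring G\<^esub> (g \<otimes>\<^bsub>group_ring G\<^esub> h)"
      by (intro group_ring_mult_assoc) (simp_all add: group_ring_def)
  next
    fix f g
    assume "f \<in> carrier (group_ring G)" "g \<in> carrier (group_ring G)"
    then show "f \<otimes>\<^bsub>group_ring G\<^esub> g \<in> carrier (group_ring G)"
      using group_ring_mult_closed[of f g] by (simp add: group_ring_def)
  qed (simp add: group_ring_def)
qed (simp_all add: group_ring_def frag_extend_add frag_extend_fun_add)

lemma ideal_aug_ideal: "ideal (aug_ideal G) (group_ring G)"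
proof -
  interpret R: ring "group_ring G" by (rule ring_group_ring)
  have minus: "\<ominus>\<^bsub>group_ring G\<^esub> f = - f" if "f \<in> carrier (group_ring G)" for f
    using that by (intro R.minus_equality) (auto simp: group_ring_def)
  show ?thesis
  proof (rule idealI[OF ring_group_ring])
    show "subgroup (aug_ideal G) (add_monoid (group_ring G))"
    proof (rule R.add.subgroupI)
      fix f assume f: "f \<in> aug_ideal G"
      then have "augmentation (- f) = 0"
        using augmentation_diff[of 0 f] by (simp add: aug_ideal_def)
      then show "\<ominus>\<^bsub>group_ring G\<^esub> f \<in> aug_ideal G"
        using f minus[of f] by (simp add: aug_ideal_def group_ring_def)
    next
      show "aug_ideal G \<noteq> {}"
        by (auto simp: aug_ideal_def group_ring_def intro!: exI[of _ 0])
    next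
      fix f g assume "f \<in> aug_ideal G" "g \<in> aug_ideal G"
      moreover from this have "augmentation (f \<oplus>\<^bsub>group_ring G\<^esub> g) = 0"
        by (simp add: aug_ideal_def group_ring_def augmentation_add)
      ultimately show "f \<oplus>\<^bsub>group_ring G\<^esub> g \<in> aug_ideal G"
        by (simp add: aug_ideal_def)
    qed (auto simp: aug_ideal_def)
  qed (auto simp: aug_ideal_def augmentation_mult)
qed

end


section \<open>Nilpotent groups, torsion and infinite height\<close>

text \<open>The series is indexed from 1; index 0 is a duplicate of index 1.\<close>

fun lower_central :: "('a, 'm) monoid_scheme \<Rightarrow> nat \<Rightarrow> 'a set"
  where
    "lower_central H 0 = carrier H"
  | "lower_central H (Suc 0) = carrier H"
  | "lower_central H (Suc (Suc n)) = generate H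
      {x \<otimes>\<^bsub>H\<^esub> y \<otimes>\<^bsub>H\<^esub> inv\<^bsub>H\<^esub> x \<otimes>\<^bsub>H\<^esub> inv\<^bsub>H\<^esub> y | x y. x \<in> lower_central H (Suc n) \<and> y \<in> carrier H}"

definition nilpotent_group :: "('a, 'm) monoid_scheme \<Rightarrow> bool"
  where "nilpotent_group G \<longleftrightarrow> group G \<and> (\<exists>c. lower_central G (Suc c) = {\<one>\<^bsub>G\<^esub>})"

text \<open>For nilpotent \<open>G\<close> this set is a subgroup.\<close>

definition torsion_part :: "('a, 'm) monoid_scheme \<Rightarrow> 'a set"
  where "torsion_part G = {x \<in> carrier G. \<exists>n>0. x [^]\<^bsub>G\<^esub> (n::nat) = \<one>\<^bsub>G\<^esub>}"

definition torsion_free :: "('a, 'm) monoid_scheme \<Rightarrow> bool"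
  where "torsion_free G \<longleftrightarrow> torsion_part G = {\<one>\<^bsub>G\<^esub>}"

definition p_group :: "nat \<Rightarrow> ('a, 'm) monoid_scheme \<Rightarrow> bool"
  where "p_group p H \<longleftrightarrow> (\<forall>x\<in>carrier H. \<exists>k. group.ord H x = p ^ k)"

definition two_three_group :: "('a, 'm) monoid_scheme \<Rightarrow> bool"
  where "two_three_group H \<longleftrightarrow> (\<forall>x\<in>carrier H. \<exists>a b. group.ord H x = 2 ^ a * 3 ^ b)"

definition two_three_torsion_free :: "('a, 'm) monoid_scheme \<Rightarrow> bool"
  where "two_three_torsion_free H \<longleftrightarrow>
    \<not> (\<exists>x\<in>carrier H. group.ord H x = 2 \<or> group.ord H x = 3)"

definition has_exponent :: "('a, 'm) monoid_scheme \<Rightarrow> nat \<Rightarrow> bool"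
  where "has_exponent H e \<longleftrightarrow>
    e > 0 \<and> (\<forall>x\<in>carrier H. x [^]\<^bsub>H\<^esub> e = \<one>\<^bsub>H\<^esub>) \<and>
    (\<forall>m>0. (\<forall>x\<in>carrier H. x [^]\<^bsub>H\<^esub> m = \<one>\<^bsub>H\<^esub>) \<longrightarrow> e \<le> m)"

definition infinite_height :: "('a, 'm) monoid_scheme \<Rightarrow> nat \<Rightarrow> 'a set"
  where "infinite_height H p = {g \<in> carrier H. \<forall>i j. j \<ge> 1 \<longrightarrow>
    (\<exists>x\<in>carrier H. \<exists>y\<in>lower_central H j. x [^]\<^bsub>H\<^esub> (p ^ i) = g \<otimes>\<^bsub>H\<^esub> y)}"

end

theory Submission
  imports Defs "HOL-Number_Theory.Number_Theory" "HOL-Computational_Algebra.Polynomial" Complex_Main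
begin

text \<open>
  Call \<open>g\<close>, \<open>h\<close> an \<^emph>\<open>omega pair\<close> (\<open>omega_pair\<close>) if \<open>(g - 1)(h - 1)\<close> and \<open>(h - 1)(g - 1)\<close> lie in
  \<open>\<Delta>\<^sup>\<omega>\<close>, the intersection of all \<open>\<Delta>\<^sup>n\<close>. They occur whenever \<open>h\<^sup>N = 1\<close> and \<open>g\<close> has an \<open>N\<^sup>i\<close>-th
  root for every \<open>i\<close> (\<open>omega_pairI\<close>): torsion of \<open>h\<close> makes \<open>N\<^sup>s (h - 1)\<close> fall into \<open>\<Delta>\<^bsup>s+1\<^esup>\<close>, and
  \<open>y\<^sup>N - 1 = (y - 1)(N + d)\<close> with \<open>d \<in> \<Delta>\<close>, so that every extraction of a root gains one power of
  \<open>\<Delta>\<close>, either through \<open>N\<close> or through \<open>d\<close>. Two sources matter: torsion elements of coprime orders,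
  and an element of \<open>T(p)\<close> together with any element of the \<open>p\<close>-group \<open>T\<close>.

  Assume \<open>\<V>\<^sub>\<omega> = {1}\<close>. An omega pair commutes, because \<open>gh - hg \<in> \<Delta>\<^sup>\<omega>\<close> puts the commutator \<open>[g, h]\<close>
  into \<open>\<V>\<^sub>\<omega>\<close>. More units arise inside the group ring of a cyclic group \<open>\<langle>x\<rangle>\<close> of order \<open>n\<close>, whose
  elements are written \<open>U(x)\<close> with an integer polynomial \<open>U\<close>. If \<open>x\<close>, \<open>x\<close> is an omega pair, then every
  unit \<open>U(x)\<close> of augmentation one becomes an element of \<open>\<V>\<^sub>\<omega>\<close> after multiplication by a power of
  \<open>x\<close>; hence \<open>|U(\<zeta>)| = 1\<close> at every \<open>n\<close>-th root of unity \<open>\<zeta>\<close> (\<open>cyclic_unit_root_of_unity\<close>). If \<open>g\<close>,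
  \<open>h\<close> have coprime orders and \<open>x = gh\<close>, then \<open>U(x) U(g)\<^sup>-\<^sup>1 U(h)\<^sup>-\<^sup>1 \<in> \<V>\<^sub>\<omega>\<close>; hence \<open>U(\<alpha>\<beta>) = U(\<alpha>) U(\<beta>)\<close> for
  roots of unity \<open>\<alpha>\<close>, \<open>\<beta>\<close> of these orders (\<open>coprime_orders_unit_factors\<close>). The Bass units, for
  which \<open>U(\<zeta>) = ((\<zeta>\<^sup>k - 1) / (\<zeta> - 1))\<^sup>r\<close>, violate these conclusions unless the order of \<open>x\<close> is small:
  an element of prime power order that is an omega pair with itself has order at most \<open>4\<close>, and coprime
  orders \<open>> 1\<close> of two elements can only be \<open>2\<close> and \<open>3\<close>.

  The theorem follows. If \<open>T\<close> is not a \<open>p\<close>-group, it contains nontrivial elements of coprime orders, thus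
  elements of orders \<open>2\<close> and \<open>3\<close>, and comparing an arbitrary element with these two leaves only orders
  dividing \<open>6\<close>. If \<open>T \<noteq> {1}\<close> is a \<open>p\<close>-group, then \<open>T(p)\<close> is central in \<open>T\<close> with elements of order at
  most \<open>4\<close>. It differs from \<open>T\<close>, because \<open>T(p) = T\<close> would give a bounded group all of whose elements have
  \<open>p\<^sup>2\<close>-th roots. For \<open>p \<ge> 5\<close> it is trivial, which yields the statement on \<open>{2,3}\<close>-torsion-free
  \<open>T\<close>.

  Two facts on nilpotent groups complete the argument: the torsion elements form a subgroup
  (\<open>torsion_part_subgroup\<close>), and so do the elements of infinite height if they are central
  (\<open>infinite_height_subgroup\<close>). The latter holds because sufficiently deep powers of two roots of
  central elements commute.
\<close>

section \<open>Powers of the augmentation ideal\<close>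

context group
begin

abbreviation gr_mult :: "('a \<Rightarrow>\<^sub>0 int) \<Rightarrow> ('a \<Rightarrow>\<^sub>0 int) \<Rightarrow> ('a \<Rightarrow>\<^sub>0 int)" (infixl "\<star>" 70)
  where "f \<star> g \<equiv> f \<otimes>\<^bsub>group_ring G\<^esub> g"

abbreviation RG :: "('a \<Rightarrow>\<^sub>0 int) set"
  where "RG \<equiv> carrier (group_ring G)"

abbreviation aug_pow :: "nat \<Rightarrow> ('a \<Rightarrow>\<^sub>0 int) set"
  where "aug_pow n \<equiv> ideal_power (group_ring G) (aug_ideal G) n"

definition aug_omega :: "('a \<Rightarrow>\<^sub>0 int) set"
  where "aug_omega = (\<Inter>n. aug_pow n)"

lemma gr_simps:
  "\<one>\<^bsub>group_ring G\<^esub> = frag_of \<one>" "\<zero>\<^bsub>group_ring G\<^esub> = 0"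
  "f \<oplus>\<^bsub>group_ring G\<^esub> g = f + g"
  by (simp_all add: group_ring_def)

lemma gr_mult_frag_of [simp]: "frag_of x \<star> frag_of y = frag_of (x \<otimes> y)"
  by (simp add: group_ring_def)

lemma gr_mult_add:
  "(f + g) \<star> h = f \<star> h + g \<star> h" "f \<star> (g + h) = f \<star> g + f \<star> h"
  by (simp_all add: group_ring_def frag_extend_add frag_extend_fun_add)

lemma gr_mult_diff:
  "(f - g) \<star> h = f \<star> h - g \<star> h" "f \<star> (g - h) = f \<star> g - f \<star> h"
  by (simp_all add: group_ring_def frag_extend_diff frag_extend_fun_diff)

lemma gr_mult_zero [simp]: "0 \<star> f = 0" "f \<star> 0 = 0"
  using gr_mult_diff(1)[of 0 0 f] gr_mult_diff(2)[of f 0 0] by simp_all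

lemma frag_extend_fun_cmul: "frag_extend (\<lambda>x. frag_cmul c (f x)) g = frag_cmul c (frag_extend f g)"
  by (simp add: frag_extend_def frag_cmul_sum mult.commute)

lemma gr_mult_cmul:
  "frag_cmul c f \<star> g = frag_cmul c (f \<star> g)" "f \<star> frag_cmul c g = frag_cmul c (f \<star> g)"
  by (simp_all add: group_ring_def frag_extend_cmul frag_extend_fun_cmul)

lemma gr_carrier [simp]:
  "0 \<in> RG" "f \<in> RG \<Longrightarrow> g \<in> RG \<Longrightarrow> f + g \<in> RG" "f \<in> RG \<Longrightarrow> g \<in> RG \<Longrightarrow> f - g \<in> RG"
  "f \<in> RG \<Longrightarrow> frag_cmul c f \<in> RG" "f \<in> RG \<Longrightarrow> g \<in> RG \<Longrightarrow> f \<star> g \<in> RG"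
  "frag_of x \<in> RG \<longleftrightarrow> x \<in> carrier G"
  using keys_add[of f g] keys_diff[of f g] keys_cmul[of c f]
    ring.ring_simprules(5)[OF ring_group_ring, of f g]
  by (auto simp: group_ring_def)

lemma gr_mult_assoc: "f \<in> RG \<Longrightarrow> g \<in> RG \<Longrightarrow> h \<in> RG \<Longrightarrow> f \<star> g \<star> h = f \<star> (g \<star> h)"
  using ring.ring_simprules[OF ring_group_ring] by simp

lemma gr_mult_one [simp]: "f \<in> RG \<Longrightarrow> f \<star> frag_of \<one> = f" "f \<in> RG \<Longrightarrow> frag_of \<one> \<star> f = f"
  using monoid.r_one[OF ring.is_monoid[OF ring_group_ring], of f]
    monoid.l_one[OF ring.is_monoid[OF ring_group_ring], of f] by (simp_all add: gr_simps)

lemma ideal_aug_pow: "ideal (aug_pow n) (group_ring G)"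
proof (induction n)
  case 0
  then show ?case by (simp add: ring.oneideal[OF ring_group_ring])
next
  case (Suc n)
  then show ?case
    by (simp add: ring.ideal_prod_is_ideal[OF ring_group_ring _ ideal_aug_ideal])
qed

lemma aug_pow_carrier: "f \<in> aug_pow n \<Longrightarrow> f \<in> RG"
  using ideal.Icarr[OF ideal_aug_pow] .

lemma aug_pow_mult:
  "f \<in> aug_pow n \<Longrightarrow> g \<in> RG \<Longrightarrow> f \<star> g \<in> aug_pow n"
  "f \<in> aug_pow n \<Longrightarrow> g \<in> RG \<Longrightarrow> g \<star> f \<in> aug_pow n"
  using ideal.I_r_closed[OF ideal_aug_pow] ideal.I_l_closed[OF ideal_aug_pow] by auto

lemma aug_pow_add: "f \<in> aug_pow n \<Longrightarrow> g \<in> aug_pow n \<Longrightarrow> f + g \<in> aug_pow n"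
  using additive_subgroup.a_closed[OF ideal.axioms(1)[OF ideal_aug_pow]]
  by (simp add: gr_simps)

lemma aug_pow_zero [simp]: "0 \<in> aug_pow n"
  using additive_subgroup.zero_closed[OF ideal.axioms(1)[OF ideal_aug_pow]]
  by (simp add: gr_simps)

lemma aug_pow_cmul: "f \<in> aug_pow n \<Longrightarrow> frag_cmul c f \<in> aug_pow n"
  using aug_pow_mult(1)[of f n "frag_cmul c (frag_of \<one>)"] aug_pow_carrier[of f n]
  by (simp add: gr_mult_cmul)

lemma aug_pow_diff: "f \<in> aug_pow n \<Longrightarrow> g \<in> aug_pow n \<Longrightarrow> f - g \<in> aug_pow n"
  using aug_pow_add[of f n "- g"] aug_pow_cmul[of g n "-1"] by simp

lemma aug_pow_SucI: "f \<in> aug_pow n \<Longrightarrow> g \<in> aug_ideal G \<Longrightarrow> f \<star> g \<in> aug_pow (Suc n)"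
  by (simp add: ideal_prod.prod)

text \<open>The powers are built by multiplying with \<open>\<Delta>\<close> on the right; in a noncommutative ring, multiplying on
the left needs an induction that pushes the left factor through the product.\<close>
lemma aug_pow_SucI': "g \<in> aug_ideal G \<Longrightarrow> f \<in> aug_pow n \<Longrightarrow> g \<star> f \<in> aug_pow (Suc n)"
proof (induction n arbitrary: f)
  case 0
  have "frag_of \<one> \<star> (g \<star> f) \<in> aug_pow (Suc 0)"
    using 0 ideal.I_r_closed[OF ideal_aug_ideal]
    by (intro aug_pow_SucI) auto
  then show ?case
    using 0 ideal.Icarr[OF ideal_aug_ideal] by simp
next
  case (Suc n)
  from Suc.prems(2) have "f \<in> ideal_prod (group_ring G) (aug_pow n) (aug_ideal G)" by simp
  then show ?case
  proof (induction rule: ideal_prod.induct)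
    case (prod i j)
    have "g \<star> i \<star> j \<in> aug_pow (Suc (Suc n))"
      using Suc.IH[OF Suc.prems(1) prod(1)] prod(2) by (rule aug_pow_SucI)
    moreover have "g \<in> RG" "i \<in> RG" "j \<in> RG"
      using Suc prod aug_pow_carrier ideal.Icarr[OF ideal_aug_ideal] by blast+
    ultimately show ?case by (simp add: gr_mult_assoc)
  next
    case (sum s t)
    then show ?case
      using aug_pow_add[of _ "Suc (Suc n)"] by (simp add: gr_simps gr_mult_add)
  qed
qed

lemma aug_pow_Suc_subset: "aug_pow (Suc n) \<subseteq> aug_pow n"
  using ring.ideal_prod_inter[OF ring_group_ring ideal_aug_pow ideal_aug_ideal] by auto

lemma aug_pow_one: "aug_pow (Suc 0) \<subseteq> aug_ideal G"
  using ring.ideal_prod_inter[OF ring_group_ring ideal_aug_pow[of 0] ideal_aug_ideal] by auto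

lemma aug_pow_one': "aug_ideal G \<subseteq> aug_pow (Suc 0)"
proof
  fix f assume "f \<in> aug_ideal G"
  then show "f \<in> aug_pow (Suc 0)"
    using aug_pow_SucI[of "frag_of \<one>" 0 f] ideal.Icarr[OF ideal_aug_ideal] by simp
qed

lemma frag_of_diff_aug: "x \<in> carrier G \<Longrightarrow> y \<in> carrier G \<Longrightarrow> frag_of x - frag_of y \<in> aug_ideal G"
  by (simp add: aug_ideal_def augmentation_diff)

lemma aug_omega_closed:
  "0 \<in> aug_omega"
  "f \<in> aug_omega \<Longrightarrow> g \<in> aug_omega \<Longrightarrow> f + g \<in> aug_omega"
  "f \<in> aug_omega \<Longrightarrow> g \<in> aug_omega \<Longrightarrow> f - g \<in> aug_omega"
  "f \<in> aug_omega \<Longrightarrow> r \<in> RG \<Longrightarrow> f \<star> r \<in> aug_omega"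
  "f \<in> aug_omega \<Longrightarrow> r \<in> RG \<Longrightarrow> r \<star> f \<in> aug_omega"
  unfolding aug_omega_def by (blast intro: aug_pow_add aug_pow_diff aug_pow_mult aug_pow_zero)+

text \<open>Membership in the augmentation one units is automatic, as \<open>u - 1\<close> lies in the augmentation ideal.\<close>
lemma units_omegaI:
  assumes "u \<in> RG" "v \<in> RG" "u \<star> v = frag_of \<one>" "v \<star> u = frag_of \<one>"
    and "u - frag_of \<one> \<in> aug_omega"
  shows "u \<in> units_omega G"
proof -
  have "u - frag_of \<one> \<in> aug_ideal G"
    using assms(5) aug_pow_one unfolding aug_omega_def by (meson INT_D UNIV_I subsetD)
  then have "augmentation u = 1"
    by (simp add: aug_ideal_def augmentation_diff)
  then have norm: "u \<in> normalized_units G"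
    using assms by (auto simp: normalized_units_def Units_def gr_simps)
  have "u - frag_of \<one> \<in> aug_pow n" for n
    using assms(5) unfolding aug_omega_def by blast
  then have "u \<in> \<one>\<^bsub>group_ring G\<^esub> <+\<^bsub>group_ring G\<^esub> aug_pow n" for n
    unfolding a_l_coset_def' gr_simps by (force intro: bexI[of _ "u - frag_of \<one>"])
  with norm show ?thesis
    by (simp add: units_omega_def units_level_def)
qed

end

section \<open>Pairs whose augmentation product lies in every power\<close>

context group
begin

text \<open>Unlike plain membership in \<open>\<Delta>\<^sup>i\<close>, this condition improves from \<open>i\<close> to \<open>i + 1\<close> under multiplication by
\<open>N + d\<close> with \<open>d \<in> \<Delta>\<close>, the kind of factor that turns \<open>y - 1\<close> into \<open>y\<^sup>N - 1\<close>.\<close>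
definition int_deep :: "nat \<Rightarrow> nat \<Rightarrow> ('a \<Rightarrow>\<^sub>0 int) \<Rightarrow> bool"
  where "int_deep N i z \<longleftrightarrow> (\<forall>s. frag_cmul (int N ^ s) z \<in> aug_pow (s + i))"

lemma int_deep_mult:
  "int_deep N i z \<Longrightarrow> r \<in> RG \<Longrightarrow> int_deep N i (r \<star> z)"
  "int_deep N i z \<Longrightarrow> r \<in> RG \<Longrightarrow> int_deep N i (z \<star> r)"
  unfolding int_deep_def using aug_pow_mult by (metis gr_mult_cmul)+

text \<open>A factor \<open>N + d\<close> with \<open>d \<in> \<Delta>\<close> gains one power on either summand: the integer \<open>N\<close> by the definition of
\<open>int_deep\<close>, and \<open>d\<close> because it lies in \<open>\<Delta>\<close>.\<close>
lemma int_deep_step: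
  assumes "int_deep N i z" "d \<in> aug_ideal G"
  shows "int_deep N (Suc i) ((frag_cmul (int N) (frag_of \<one>) + d) \<star> z)"
    "int_deep N (Suc i) (z \<star> (frag_cmul (int N) (frag_of \<one>) + d))"
proof -
  have z: "z \<in> RG"
    using assms(1) aug_pow_carrier[of z i] unfolding int_deep_def by (metis add_0 frag_cmul_one power_0)
  have a: "frag_cmul (int N ^ s * int N) z \<in> aug_pow (s + Suc i)" for s
    using assms(1)[unfolded int_deep_def, rule_format, of "Suc s"] by (simp add: mult.commute)
  have b: "d \<star> frag_cmul (int N ^ s) z \<in> aug_pow (s + Suc i)"
      "frag_cmul (int N ^ s) z \<star> d \<in> aug_pow (s + Suc i)" for s
    using assms aug_pow_SucI[of "frag_cmul (int N ^ s) z" "s + i" d]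
      aug_pow_SucI'[of d "frag_cmul (int N ^ s) z" "s + i"] unfolding int_deep_def by auto
  show "int_deep N (Suc i) ((frag_cmul (int N) (frag_of \<one>) + d) \<star> z)"
    "int_deep N (Suc i) (z \<star> (frag_cmul (int N) (frag_of \<one>) + d))"
    using aug_pow_add[OF a b(1)] aug_pow_add[OF a b(2)] z
    by (simp_all add: int_deep_def gr_mult_add gr_mult_cmul frag_cmul_distrib2)
qed

text \<open>This is \<open>y\<^sup>N - 1 = (y - 1)(1 + y + \<dots> + y\<^bsup>N-1\<^esup>)\<close>, where the second factor has augmentation \<open>N\<close>. The
two forms put the factor on either side.\<close>
lemma pow_diff_one:
  assumes "y \<in> carrier G"
  shows "\<exists>d\<in>aug_ideal G.
    frag_of (y [^] N) - frag_of \<one> = (frag_of y - frag_of \<one>) \<star> (frag_cmul (int N) (frag_of \<one>) + d) \<and>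
    frag_of (y [^] N) - frag_of \<one> = (frag_cmul (int N) (frag_of \<one>) + d) \<star> (frag_of y - frag_of \<one>)"
proof (induction N)
  case 0
  have "0 \<in> aug_ideal G" by (simp add: aug_ideal_def)
  then show ?case by (intro bexI[of _ 0]) auto
next
  case (Suc N)
  then obtain d where d: "d \<in> aug_ideal G"
    "frag_of (y [^] N) - frag_of \<one> = (frag_of y - frag_of \<one>) \<star> (frag_cmul (int N) (frag_of \<one>) + d)"
    "frag_of (y [^] N) - frag_of \<one> = (frag_cmul (int N) (frag_of \<one>) + d) \<star> (frag_of y - frag_of \<one>)"
    by blast
  define d' where "d' = d + (frag_of (y [^] N) - frag_of \<one>)"
  have eq: "frag_cmul (int (Suc N)) (frag_of \<one>) + d' = (frag_cmul (int N) (frag_of \<one>) + d) + frag_of (y [^] N)"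
    by (simp add: d'_def frag_cmul_distrib)
  have "d' \<in> aug_ideal G"
    using d(1) assms by (simp add: d'_def aug_ideal_def augmentation_add augmentation_diff)
  moreover have "(frag_of y - frag_of \<one>) \<star> (frag_cmul (int (Suc N)) (frag_of \<one>) + d') =
      frag_of (y [^] Suc N) - frag_of \<one>"
    unfolding eq gr_mult_add(2)[of _ _ "frag_of (y [^] N)"] d(2)[symmetric]
    using assms nat_pow_Suc2[of y N] by (simp add: gr_mult_diff)
  moreover have "(frag_cmul (int (Suc N)) (frag_of \<one>) + d') \<star> (frag_of y - frag_of \<one>) =
      frag_of (y [^] Suc N) - frag_of \<one>"
    unfolding eq gr_mult_add(1)[of _ "frag_of (y [^] N)"] d(3)[symmetric]
    using assms by (simp add: gr_mult_diff)
  ultimately show ?case by metis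
qed

text \<open>With \<open>t = h - 1\<close>, the relation \<open>h\<^sup>N = 1\<close> reads \<open>(N + d) t = 0\<close>, so multiplying \<open>t\<close> by \<open>N\<close> is the same as
multiplying it by \<open>-d \<in> \<Delta>\<close>.\<close>
lemma int_deep_torsion:
  assumes h: "h \<in> carrier G" and "h [^] N = \<one>"
  shows "int_deep N 1 (frag_of h - frag_of \<one>)"
proof -
  let ?t = "frag_of h - frag_of \<one>"
  obtain d where d: "d \<in> aug_ideal G" "(frag_cmul (int N) (frag_of \<one>) + d) \<star> ?t = 0"
    using pow_diff_one[OF h, of N] assms by auto
  then have "frag_cmul (int N) ?t + d \<star> ?t = 0"
    using h by (simp add: gr_mult_add gr_mult_cmul)
  then have step: "frag_cmul (int N) ?t = frag_cmul (-1) (d \<star> ?t)"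
    by (simp add: eq_neg_iff_add_eq_0)
  have "frag_cmul (int N ^ s) ?t \<in> aug_pow (s + 1)" for s
  proof (induction s)
    case 0
    then show ?case using frag_of_diff_aug[OF h, of \<one>] aug_pow_one' by auto
  next
    case (Suc s)
    have "frag_cmul (int N ^ Suc s) ?t = frag_cmul (int N ^ s) (frag_cmul (int N) ?t)"
      by (simp add: mult.commute)
    also have "\<dots> = frag_cmul (-1) (d \<star> frag_cmul (int N ^ s) ?t)"
      unfolding step by (simp add: gr_mult_cmul del: frag_cmul_minus_one)
    also have "\<dots> \<in> aug_pow (Suc (s + 1))"
      by (intro aug_pow_cmul[of "_ \<star> _"] aug_pow_SucI' Suc d(1))
    finally show ?case by simp
  qed
  then show ?thesis by (simp add: int_deep_def)
qed

text \<open>Each passage from \<open>y\<close> to \<open>y\<^sup>N\<close> multiplies \<open>y - 1\<close> by a factor \<open>N + d\<close>, which is one \<open>int_deep_step\<close>.\<close>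
lemma int_deep_root:
  assumes z: "int_deep N 1 z" and x: "x \<in> carrier G"
  shows "int_deep N (Suc i) ((frag_of (x [^] (N ^ i)) - frag_of \<one>) \<star> z) \<and>
    int_deep N (Suc i) (z \<star> (frag_of (x [^] (N ^ i)) - frag_of \<one>))"
proof (induction i)
  case 0
  then show ?case
    using int_deep_mult[OF z, of "frag_of x - frag_of \<one>"] x by simp
next
  case (Suc i)
  let ?y = "x [^] (N ^ i)"
  let ?t = "frag_of ?y - frag_of \<one>"
  have zc: "z \<in> RG"
    using z aug_pow_carrier[of z 1] unfolding int_deep_def by (metis add_0 frag_cmul_one power_0)
  obtain d where d: "d \<in> aug_ideal G"
    "frag_of (?y [^] N) - frag_of \<one> = ?t \<star> (frag_cmul (int N) (frag_of \<one>) + d)"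
    "frag_of (?y [^] N) - frag_of \<one> = (frag_cmul (int N) (frag_of \<one>) + d) \<star> ?t"
    using pow_diff_one[of ?y N] x by auto
  have dc: "d \<in> RG" using d(1) ideal.Icarr[OF ideal_aug_ideal] by blast
  have y: "x [^] (N ^ Suc i) = ?y [^] N"
    using x by (simp add: nat_pow_pow mult.commute)
  have "int_deep N (Suc (Suc i)) ((frag_cmul (int N) (frag_of \<one>) + d) \<star> (?t \<star> z))"
    "int_deep N (Suc (Suc i)) ((z \<star> ?t) \<star> (frag_cmul (int N) (frag_of \<one>) + d))"
    using Suc int_deep_step d(1) by blast+
  moreover have "(frag_cmul (int N) (frag_of \<one>) + d) \<star> (?t \<star> z) = (frag_of (?y [^] N) - frag_of \<one>) \<star> z"
    "(z \<star> ?t) \<star> (frag_cmul (int N) (frag_of \<one>) + d) = z \<star> (frag_of (?y [^] N) - frag_of \<one>)"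
    using x zc dc gr_mult_assoc[of "frag_cmul (int N) (frag_of \<one>) + d" ?t z]
      gr_mult_assoc[of z ?t "frag_cmul (int N) (frag_of \<one>) + d"] d(2,3) by simp_all
  ultimately show ?case unfolding y by simp
qed

definition omega_pair :: "'a \<Rightarrow> 'a \<Rightarrow> bool"
  where "omega_pair g h \<longleftrightarrow>
    (frag_of g - frag_of \<one>) \<star> (frag_of h - frag_of \<one>) \<in> aug_omega \<and>
    (frag_of h - frag_of \<one>) \<star> (frag_of g - frag_of \<one>) \<in> aug_omega"

lemma omega_pairI:
  fixes N :: nat
  assumes "h \<in> carrier G" "h [^] N = \<one>" and roots: "\<And>i. \<exists>x\<in>carrier G. x [^] (N ^ i) = g"
  shows "omega_pair g h"
proof -
  have "(frag_of g - frag_of \<one>) \<star> (frag_of h - frag_of \<one>) \<in> aug_pow n \<and>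
    (frag_of h - frag_of \<one>) \<star> (frag_of g - frag_of \<one>) \<in> aug_pow n" for n
  proof -
    obtain x where "x \<in> carrier G" "x [^] (N ^ n) = g" using roots by blast
    with int_deep_root[OF int_deep_torsion[of h N], of x n] assms(1,2)
    have "int_deep N (Suc n) ((frag_of g - frag_of \<one>) \<star> (frag_of h - frag_of \<one>))"
      "int_deep N (Suc n) ((frag_of h - frag_of \<one>) \<star> (frag_of g - frag_of \<one>))" by auto
    then have "(frag_of g - frag_of \<one>) \<star> (frag_of h - frag_of \<one>) \<in> aug_pow (Suc n)"
      "(frag_of h - frag_of \<one>) \<star> (frag_of g - frag_of \<one>) \<in> aug_pow (Suc n)"
      unfolding int_deep_def by (auto dest!: spec[of _ 0] simp del: ideal_power.simps)
    then show ?thesis using aug_pow_Suc_subset[of n] by blast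
  qed
  then show ?thesis by (simp add: omega_pair_def aug_omega_def)
qed

text \<open>An element of order prime to \<open>N\<close> has \<open>N\<^sup>i\<close>-th roots inside the cyclic group that it generates.\<close>
lemma omega_pair_coprime:
  fixes M N :: nat
  assumes g: "g \<in> carrier G" "g [^] M = \<one>" and h: "h \<in> carrier G" "h [^] N = \<one>" and "coprime M N"
  shows "omega_pair g h"
proof (rule omega_pairI[OF h])
  fix i
  show "\<exists>x\<in>carrier G. x [^] (N ^ i) = g"
  proof (cases "M = 0")
    case True
    then have "N = 1" using \<open>coprime M N\<close> coprime_0_left_iff[of N] by simp
    then show ?thesis using g by auto
  next
    case False
    have "coprime (N ^ i) M" using \<open>coprime M N\<close> by (simp add: coprime_commute)
    from cong_solve_coprime_nat[OF this] obtain a where "[N ^ i * a = 1] (mod M)" by auto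
    then have "[int (a * N ^ i) = int 1] (mod int M)"
      by (simp only: cong_int_iff mult.commute)
    then have "int (ord g) dvd int 1 - int (a * N ^ i)"
      using g pow_eq_id[of g M] by (metis cong_iff_dvd_diff cong_sym dvd_trans int_dvd_int_iff)
    then have "g [^] (a * N ^ i) = g [^] (1::nat)"
      using g(1) int_pow_eq[of g "int (a * N ^ i)" "int 1"] by (simp only: int_pow_int)
    then show ?thesis
      using g by (intro bexI[of _ "g [^] a"]) (auto simp: nat_pow_pow)
  qed
qed

text \<open>The difference of the two products is \<open>gh - hg\<close>; multiplied by \<open>(hg)\<^sup>-\<^sup>1\<close> it becomes \<open>[g, h] - 1\<close>, so the
commutator is a trivial unit in \<open>\<V>\<^sub>\<omega>\<close>.\<close>
lemma omega_pair_commute: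
  assumes triv: "units_omega G = {\<one>\<^bsub>group_ring G\<^esub>}"
    and g: "g \<in> carrier G" and h: "h \<in> carrier G" and "omega_pair g h"
  shows "g \<otimes> h = h \<otimes> g"
proof -
  let ?k = "g \<otimes> h \<otimes> inv (h \<otimes> g)"
  have "(frag_of g - frag_of \<one>) \<star> (frag_of h - frag_of \<one>) - (frag_of h - frag_of \<one>) \<star> (frag_of g - frag_of \<one>)
      \<in> aug_omega"
    using \<open>omega_pair g h\<close> by (simp add: omega_pair_def aug_omega_closed)
  then have "frag_of (g \<otimes> h) - frag_of (h \<otimes> g) \<in> aug_omega"
    using g h by (simp add: gr_mult_diff algebra_simps)
  then have "(frag_of (g \<otimes> h) - frag_of (h \<otimes> g)) \<star> frag_of (inv (h \<otimes> g)) \<in> aug_omega"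
    using g h by (intro aug_omega_closed(4)) auto
  then have "frag_of ?k - frag_of \<one> \<in> aug_omega"
    using g h by (simp add: gr_mult_diff)
  then have "frag_of ?k \<in> units_omega G"
    using g h by (intro units_omegaI[of _ "frag_of (inv ?k)"]) auto
  then have "?k = \<one>"
    using triv by (simp add: gr_simps frag_of_eq)
  then show ?thesis
    using g h by (metis inv_closed inv_inv inv_equality m_closed)
qed

end

section \<open>Integer polynomials modulo cyclic polynomials\<close>

abbreviation cyc :: "nat \<Rightarrow> int poly"
  where "cyc n \<equiv> monom 1 n - 1"

abbreviation geo :: "nat \<Rightarrow> int poly"
  where "geo n \<equiv> \<Sum>i<n. monom 1 i"

definition cpoly :: "int poly \<Rightarrow> complex \<Rightarrow> complex"
  where "cpoly P z = poly (map_poly of_int P) z"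

lemma cpoly_simps [simp]:
  "cpoly 0 z = 0" "cpoly (pCons a P) z = of_int a + z * cpoly P z"
  by (simp_all add: cpoly_def map_poly_pCons)

lemma cpoly_add [simp]: "cpoly (P + Q) z = cpoly P z + cpoly Q z"
  by (induction P Q rule: poly_induct2) (simp_all add: algebra_simps)

lemma cpoly_smult [simp]: "cpoly (smult c P) z = of_int c * cpoly P z"
  by (induction P) (simp_all add: algebra_simps)

lemma cpoly_mult [simp]: "cpoly (P * Q) z = cpoly P z * cpoly Q z"
  by (induction P) (simp_all add: algebra_simps)

lemma cpoly_diff [simp]: "cpoly (P - Q) z = cpoly P z - cpoly Q z"
  using cpoly_add[of "P - Q" Q z] by (simp only: diff_add_cancel eq_diff_eq)

lemma cpoly_1 [simp]: "cpoly 1 z = 1"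
  by (simp add: one_pCons)

lemma cpoly_power [simp]: "cpoly (P ^ r) z = cpoly P z ^ r"
  by (induction r) simp_all

lemma cpoly_monom [simp]: "cpoly (monom a n) z = of_int a * z ^ n"
  by (induction n) (simp_all add: monom_0 monom_Suc)

lemma cpoly_pcompose [simp]: "cpoly (pcompose P Q) z = cpoly P (cpoly Q z)"
  by (induction P) (simp_all add: pcompose_pCons)

lemma poly_monom_induct [case_names monom add]:
  assumes "\<And>a n. Q (monom a n)" "\<And>p q. Q p \<Longrightarrow> Q q \<Longrightarrow> Q (p + q)"
  shows "Q (p :: 'a :: comm_monoid_add poly)"
proof -
  have "Q (\<Sum>i\<le>m. monom (coeff p i) i)" for m
    by (induction m) (use assms in auto)
  then show ?thesis by (metis poly_as_sum_of_monoms)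
qed

lemma poly_one_root_iff: "poly P 1 = 0 \<longleftrightarrow> cyc (Suc 0) dvd (P :: int poly)"
proof -
  have "cyc (Suc 0) = [:- 1, 1:]" by (simp add: monom_altdef one_pCons)
  then show ?thesis by (metis poly_eq_0_iff_dvd)
qed

lemma cyc_one_nonzero: "cyc (Suc 0) \<noteq> 0"
proof -
  have "coeff (cyc (Suc 0)) (Suc 0) \<noteq> coeff 0 (Suc 0)" by simp
  then show ?thesis by metis
qed

lemma monom_one_power: "monom 1 (a * b) = (monom 1 a :: int poly) ^ b"
  by (simp add: monom_power)

lemma cyc_mult_geo: "cyc k * (\<Sum>i<l. monom 1 (k * i)) = cyc (k * l)"
  using power_diff_1_eq[of "monom 1 k :: int poly" l] by (simp add: monom_one_power)

lemma cyc_one_mult_geo: "cyc (Suc 0) * geo n = cyc n"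
  using cyc_mult_geo[of "Suc 0" n] by simp

lemma cyc_dvd_cyc_mult: "cyc n dvd cyc (n * k)"
  by (metis cyc_mult_geo dvd_triv_left)

lemma cyc_dvd_monom_diff:
  assumes "[i = j] (mod n)"
  shows "cyc n dvd monom 1 i - monom 1 j"
proof -
  have *: "cyc n dvd monom 1 (j + n * q) - monom 1 j" for q j
  proof -
    have "monom 1 (j + n * q) - monom 1 j = monom 1 j * cyc (n * q)"
      by (simp add: mult_monom algebra_simps)
    then show ?thesis using cyc_dvd_cyc_mult by simp
  qed
  consider q where "i = j + n * q" | q where "j = i + n * q"
  proof (cases "j \<le> i")
    case True
    then have "n dvd i - j" using assms mod_eq_dvd_iff_nat[of j i n] by (simp add: cong_def)
    then show ?thesis using that(1) True by (metis dvdE le_add_diff_inverse)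
  next
    case False
    then have "n dvd j - i" using assms mod_eq_dvd_iff_nat[of i j n] by (simp add: cong_def)
    then show ?thesis using that(2) False by (metis dvdE le_add_diff_inverse nat_le_linear)
  qed
  then show ?thesis
  proof cases
    case 1
    then show ?thesis using * by simp
  next
    case 2
    then show ?thesis using *[of i q] by (metis dvd_minus_iff minus_diff_eq)
  qed
qed

lemma poly_geo_one [simp]: "poly (geo n) 1 = int n"
  by (simp add: poly_sum poly_monom)

text \<open>A multiple of \<open>1 + X + \<dots> + X\<^bsup>n-1\<^esup>\<close> is determined modulo \<open>X\<^sup>n - 1\<close> by its value at \<open>1\<close>; here this value
has to vanish.\<close>
lemma poly_geo_multiple:
  assumes "n > 0" "poly P 1 = 1" "P - 1 = cyc n * A + geo n * B"
  shows "cyc n dvd P - 1"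
proof -
  have "poly (P - 1) 1 = 0" using assms(2) by simp
  then have "int n * poly B 1 = 0"
    unfolding assms(3) by (simp add: poly_monom)
  then have "cyc (Suc 0) dvd B" using assms(1) poly_one_root_iff by simp
  then have "cyc (Suc 0) * geo n dvd B * geo n"
    by (rule mult_dvd_mono) simp
  then have "cyc n dvd geo n * B"
    unfolding cyc_one_mult_geo by (simp only: mult.commute)
  then show ?thesis using assms(3) by simp
qed

text \<open>Modulo \<open>X\<^sup>n - 1\<close>, the factor \<open>X - 1\<close> can be cancelled up to multiples of \<open>1 + X + \<dots> + X\<^bsup>n-1\<^esup>\<close>. Since
\<open>(X\<^sup>k - 1)/(X - 1)\<close> and \<open>(X\<^bsup>kl\<^esup> - 1)/(X\<^sup>k - 1)\<close> have product \<open>(X\<^bsup>kl\<^esup> - 1)/(X - 1)\<close> and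
\<open>X\<^bsup>kl\<^esup> \<equiv> X\<close>, they are inverse to each other up to such a multiple.\<close>
lemma geo_almost_inverse:
  assumes "k * l = 1 + d * n"
  shows "cyc n dvd geo k * (\<Sum>i<l. monom 1 (k * i)) - 1 - smult (int d) (geo n)"
proof -
  let ?T = "\<Sum>i<l. monom 1 (k * i) :: int poly" and ?D = "\<Sum>i<d. monom 1 (n * i) :: int poly"
  have "poly (monom 1 (Suc 0) * ?D - [:int d:]) 1 = 0"
    by (simp add: poly_monom poly_sum)
  then obtain M where M: "monom 1 (Suc 0) * ?D - [:int d:] = cyc (Suc 0) * M"
    unfolding poly_one_root_iff by (rule dvdE)
  have "cyc (Suc 0) * (geo k * ?T - 1 - smult (int d) (geo n)) = cyc (Suc 0) * geo k * ?T - cyc (Suc 0) - smult (int d) (cyc (Suc 0) * geo n)"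
    by (simp only: right_diff_distrib mult.assoc mult_1_right mult_smult_right)
  also have "\<dots> = cyc (1 + n * d) - cyc (Suc 0) - smult (int d) (cyc n)"
    unfolding cyc_one_mult_geo cyc_mult_geo assms by (simp add: mult.commute)
  also have "\<dots> = monom 1 (Suc 0) * cyc (n * d) - smult (int d) (cyc n)"
    by (simp add: mult_monom algebra_simps)
  also have "\<dots> = cyc n * (monom 1 (Suc 0) * ?D - [:int d:])"
    unfolding cyc_mult_geo[symmetric]
    by (simp only: smult_one[symmetric] right_diff_distrib mult_smult_right mult_1_right mult.left_commute)
  also have "\<dots> = cyc (Suc 0) * (cyc n * M)"
    unfolding M by (simp only: mult.left_commute)
  finally have "geo k * ?T - 1 - smult (int d) (geo n) = cyc n * M"
    using cyc_one_nonzero by simp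
  then show ?thesis by simp
qed

lemma pcompose_monom_monom: "pcompose (monom a i) (monom 1 m) = smult a (monom 1 m ^ i)"
  by (induction i) (simp_all add: monom_0 monom_Suc pcompose_pCons)

text \<open>For complementary idempotents \<open>e\<close>, \<open>f\<close> modulo \<open>n\<close>, the substitutions \<open>X\<^sup>e\<close> and \<open>X\<^sup>f\<close> project a cyclic
group of order \<open>n\<close> onto two direct factors, and \<open>J\<close> contains the products of their augmentation
elements. Every \<open>P(X) - P(X\<^sup>e) - P(X\<^sup>f) + P(1)\<close> lies in \<open>J\<close>, because for \<open>P = X\<^sup>i\<close> it is congruent to
\<open>(X\<^bsup>ei\<^esup> - 1)(X\<^bsup>fi\<^esup> - 1)\<close> modulo \<open>X\<^sup>n - 1\<close>; subtracting \<open>(U(X\<^sup>e) - 1)(U(X\<^sup>f) - 1) \<in> J\<close> gives the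
claim.\<close>
lemma coprime_split_mem:
  fixes J :: "int poly set" and U :: "int poly"
  assumes add: "\<And>P Q. P \<in> J \<Longrightarrow> Q \<in> J \<Longrightarrow> P + Q \<in> J"
    and mult: "\<And>P Q. P \<in> J \<Longrightarrow> Q * P \<in> J"
    and n: "cyc n \<in> J" and ef: "cyc e * cyc f \<in> J" and "[e + f = 1] (mod n)"
    and U: "poly U 1 = 1"
  shows "U - pcompose U (monom 1 e) * pcompose U (monom 1 f) \<in> J"
proof -
  let ?e = "\<lambda>P. pcompose P (monom 1 e)" and ?f = "\<lambda>P. pcompose P (monom 1 f)"
  have dvd: "P \<in> J" if "cyc n dvd P \<or> cyc e * cyc f dvd P" for P
    using that n ef mult by (metis dvdE mult.commute)
  have "P - ?e P - ?f P + [:poly P 1:] \<in> J" for P :: "int poly"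
  proof (induction P rule: poly_monom_induct)
    case (monom a i)
    have 1: "cyc n dvd monom 1 i - monom 1 ((e + f) * i)"
    proof (rule cyc_dvd_monom_diff)
      show "[i = (e + f) * i] (mod n)"
        using cong_scalar_right[OF \<open>[e + f = 1] (mod n)\<close>, of i] by (simp add: cong_sym)
    qed
    have 2: "cyc e * cyc f dvd (monom 1 e ^ i - 1) * (monom 1 f ^ i - 1)"
      by (intro mult_dvd_mono) (simp_all add: power_diff_1_eq)
    have 3: "monom 1 ((e + f) * i) = monom 1 e ^ i * (monom 1 f ^ i :: int poly)"
      by (simp add: monom_power mult_monom algebra_simps)
    have "monom a i - ?e (monom a i) - ?f (monom a i) + [:poly (monom a i) 1:] =
        [:a:] * (monom 1 i - monom 1 ((e + f) * i)) + [:a:] * ((monom 1 e ^ i - 1) * (monom 1 f ^ i - 1))"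
      unfolding 3 by (simp add: pcompose_monom_monom poly_monom algebra_simps smult_add_right smult_diff_right)
        (simp add: smult_monom)
    then show ?case using add mult dvd 1 2 by metis
  next
    case (add P Q)
    have "P + Q - ?e (P + Q) - ?f (P + Q) + [:poly (P + Q) 1:] =
        (P - ?e P - ?f P + [:poly P 1:]) + (Q - ?e Q - ?f Q + [:poly Q 1:])"
      by (simp add: pcompose_add)
    with add.IH show ?case using assms(1) by metis
  qed
  then have 1: "U - ?e U - ?f U + 1 \<in> J"
    using U by (metis one_pCons)
  obtain B where B: "U - 1 = cyc (Suc 0) * B"
    using poly_one_root_iff[of "U - 1"] U by (auto elim: dvdE)
  have "pcompose U (monom 1 m) - 1 = cyc m * pcompose B (monom 1 m)" for m
  proof -
    have "pcompose (U - 1) (monom 1 m) = pcompose (cyc (Suc 0)) (monom 1 m) * pcompose B (monom 1 m)"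
      unfolding B pcompose_mult ..
    then show ?thesis
      by (simp add: pcompose_diff pcompose_1 monom_Suc monom_0 pcompose_pCons)
  qed
  then have "(?e U - 1) * (?f U - 1) = (cyc e * cyc f) * (pcompose B (monom 1 e) * pcompose B (monom 1 f))"
    by (simp only: mult_ac)
  then have "(?e U - 1) * (?f U - 1) \<in> J"
    using dvd by (metis dvd_triv_left)
  then have 2: "- 1 * ((?e U - 1) * (?f U - 1)) \<in> J"
    by (rule mult)
  have "U - ?e U * ?f U = (U - ?e U - ?f U + 1) + - 1 * ((?e U - 1) * (?f U - 1))"
    by (simp add: algebra_simps)
  then show ?thesis using add[OF 1 2] by metis
qed

section \<open>Bass units\<close>

text \<open>The power \<open>((X\<^sup>k - 1)/(X - 1))\<^sup>r\<close> with \<open>r = \<phi>(n)\<close> has value \<open>k\<^sup>r \<equiv> 1\<close> modulo \<open>n\<close> at \<open>1\<close>. A multiple of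
\<open>1 + X + \<dots> + X\<^bsup>n-1\<^esup>\<close> corrects this value to \<open>1\<close> and is invisible at all \<open>n\<close>-th roots of unity other
than \<open>1\<close>. The same correction of the almost inverse gives an inverse.\<close>
lemma bass_unit:
  assumes n: "n > 1" and "coprime k n"
  obtains U U' :: "int poly" and r :: nat
  where "r > 0" "poly U 1 = 1" "cyc n dvd U * U' - 1"
    "\<And>z. z ^ n = 1 \<Longrightarrow> z \<noteq> 1 \<Longrightarrow> (z - 1) ^ r * cpoly U z = (z ^ k - 1) ^ r"
proof -
  obtain l where l: "[k * l = Suc 0] (mod n)"
    using \<open>coprime k n\<close> coprime_iff_invertible_nat by blast
  then have ln: "coprime l n"
    using coprime_iff_invertible_nat[of l n] by (auto simp: mult.commute)
  have "k * l mod n = 1" using l n by (simp add: cong_def)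
  then have d: "k * l = 1 + (k * l div n) * n"
    using div_mult_mod_eq[of "k * l" n] by linarith
  define d where "d = k * l div n"
  note d = d[folded d_def]
  define r where "r = totient n"
  have "r > 0" using n by (simp add: r_def)
  have euler: "\<exists>c. int m ^ r = 1 + c * int n" if "coprime m n" for m
  proof -
    have "[int m ^ r = 1] (mod int n)"
      using euler_theorem[OF that] cong_int_iff[of "m ^ r" 1 n] by (simp add: r_def)
    then have "int n dvd int m ^ r - 1" by (simp add: cong_iff_dvd_diff)
    then obtain c where "int m ^ r - 1 = int n * c" by (elim dvdE)
    then show ?thesis by (intro exI[of _ c]) (simp add: algebra_simps)
  qed
  obtain c where c: "int k ^ r = 1 + c * int n" using euler assms by blast
  obtain c' where c': "int l ^ r = 1 + c' * int n" using euler ln by blast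
  define T where "T = (\<Sum>i<l. monom 1 (k * i) :: int poly)"
  define U where "U = geo k ^ r - smult c (geo n)"
  define U' where "U' = T ^ r - smult c' (geo n)"
  have U1: "poly U 1 = 1" by (simp add: U_def poly_power c)
  have U'1: "poly U' 1 = 1" by (simp add: U'_def T_def poly_power poly_sum poly_monom c')
  obtain M where M: "geo k * T - 1 - smult (int d) (geo n) = cyc n * M"
    using geo_almost_inverse[OF d] by (auto simp: T_def)
  define Q where "Q = (\<Sum>i<r. (geo k * T) ^ i)"
  have "U * U' - 1 = ((geo k * T) ^ r - 1) - geo n * (smult c (T ^ r) + smult c' (geo k ^ r) - smult (c * c') (geo n))"
    by (simp add: U_def U'_def power_mult_distrib algebra_simps smult_add_right smult_diff_right)
  also have "(geo k * T) ^ r - 1 = (geo k * T - 1) * Q"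
    unfolding Q_def by (rule power_diff_1_eq)
  also have "geo k * T - 1 = cyc n * M + smult (int d) (geo n)"
    using M by (simp add: algebra_simps)
  also have "(cyc n * M + smult (int d) (geo n)) * Q -
      geo n * (smult c (T ^ r) + smult c' (geo k ^ r) - smult (c * c') (geo n)) =
    cyc n * (M * Q) + geo n * (smult (int d) Q - (smult c (T ^ r) + smult c' (geo k ^ r) - smult (c * c') (geo n)))"
    by (simp only: ring_distribs mult.assoc mult_smult_left mult_smult_right)
  finally have "cyc n dvd U * U' - 1"
    using n U1 U'1 by (intro poly_geo_multiple) auto
  moreover have "(z - 1) ^ r * cpoly U z = (z ^ k - 1) ^ r" if z: "z ^ n = 1" "z \<noteq> 1" for z
  proof -
    have geo: "(z - 1) * cpoly (geo m) z = z ^ m - 1" for m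
      using arg_cong[OF cyc_one_mult_geo[of m], of "\<lambda>P. cpoly P z"] by simp
    have "cpoly (geo n) z = 0" using geo[of n] z by simp
    then show ?thesis
      using geo[of k] by (simp add: U_def flip: power_mult_distrib)
  qed
  ultimately show ?thesis using \<open>r > 0\<close> U1 that by blast
qed

section \<open>Units supported on cyclic subgroups\<close>

context group
begin

definition gr_eval :: "'a \<Rightarrow> int poly \<Rightarrow> ('a \<Rightarrow>\<^sub>0 int)"
  where "gr_eval x P = fold_coeffs (\<lambda>a r. frag_cmul a (frag_of \<one>) + frag_of x \<star> r) P 0"

lemma gr_eval_0 [simp]: "gr_eval x 0 = 0"
  by (simp add: gr_eval_def)

lemma gr_eval_pCons [simp]:
  "gr_eval x (pCons a P) = frag_cmul a (frag_of \<one>) + frag_of x \<star> gr_eval x P"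
  by (cases "P = 0 \<and> a = 0") (auto simp: gr_eval_def)

lemma gr_eval_carrier [simp]: "x \<in> carrier G \<Longrightarrow> gr_eval x P \<in> RG"
  by (induction P) simp_all

lemma gr_eval_add: "gr_eval x (P + Q) = gr_eval x P + gr_eval x Q"
  by (induction P Q rule: poly_induct2) (simp_all add: gr_mult_add frag_cmul_distrib algebra_simps)

lemma gr_eval_diff: "gr_eval x (P - Q) = gr_eval x P - gr_eval x Q"
  using gr_eval_add[of x "P - Q" Q] by (simp only: diff_add_cancel eq_diff_eq)

lemma gr_eval_smult: "gr_eval x (smult c P) = frag_cmul c (gr_eval x P)"
  by (induction P) (simp_all add: gr_mult_cmul frag_cmul_distrib2)

lemma gr_eval_mult: "x \<in> carrier G \<Longrightarrow> gr_eval x (P * Q) = gr_eval x P \<star> gr_eval x Q"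
  by (induction P) (simp_all add: gr_eval_add gr_eval_smult gr_mult_add gr_mult_cmul gr_mult_assoc)

lemma gr_eval_monom: "x \<in> carrier G \<Longrightarrow> gr_eval x (monom a n) = frag_cmul a (frag_of (x [^] n))"
  by (induction n) (simp_all add: monom_0 monom_Suc gr_mult_cmul, metis nat_pow_Suc nat_pow_Suc2)

lemma gr_eval_1 [simp]: "gr_eval x 1 = frag_of \<one>"
  by (simp add: one_pCons)

lemma gr_eval_cyc: "x \<in> carrier G \<Longrightarrow> gr_eval x (cyc n) = frag_of (x [^] n) - frag_of \<one>"
  by (simp add: gr_eval_diff gr_eval_monom)

lemma gr_eval_cong:
  assumes "x \<in> carrier G" "x [^] n = \<one>" "cyc n dvd P - Q"
  shows "gr_eval x P = gr_eval x Q"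
proof -
  obtain R where "P - Q = cyc n * R" using assms(3) by (elim dvdE)
  then have "gr_eval x P - gr_eval x Q = 0"
    using assms by (simp add: gr_eval_mult gr_eval_cyc flip: gr_eval_diff)
  then show ?thesis by simp
qed

text \<open>The character \<open>x\<^sup>i \<mapsto> z\<^sup>i\<close> of the cyclic group extends linearly to the group ring. The functional
\<open>L\<close> below is this extension, set to \<open>0\<close> on all other group elements.\<close>
lemma gr_eval_eq_imp_cpoly_eq:
  assumes x: "x \<in> carrier G" and n: "ord x > 0" and z: "z ^ ord x = 1"
    and eq: "gr_eval x P = gr_eval x Q"
  shows "cpoly P z = cpoly Q z"
proof -
  define L where "L f = (\<Sum>i\<in>{..<ord x}. of_int (Poly_Mapping.lookup f (x [^] i)) * z ^ i)" for f
  have "L (gr_eval x P) = cpoly P z" for P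
  proof (induction P rule: poly_monom_induct)
    case (monom a m)
    have pow: "x [^] i = x [^] m \<longleftrightarrow> i = m mod ord x" if "i < ord x" for i :: nat
    proof -
      have "x [^] m = x [^] (m mod ord x)"
        using x by (metis l_one mult_div_mod_eq nat_pow_closed nat_pow_mult nat_pow_one nat_pow_pow pow_ord_eq_1)
      moreover have "i \<in> {0..ord x - 1}" "m mod ord x \<in> {0..ord x - 1}"
        using that mod_less_divisor[OF n, of m] by (simp_all only: atLeastAtMost_iff) linarith+
      ultimately show ?thesis using inj_on_eq_iff[OF ord_inj[OF x]] by metis
    qed
    have "L (gr_eval x (monom a m)) = (\<Sum>i\<in>{..<ord x}. if i = m mod ord x then of_int a * z ^ i else 0)"
      unfolding L_def by (intro sum.cong) (use pow in \<open>auto simp: gr_eval_monom x\<close>)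
    also have "\<dots> = of_int a * z ^ (m mod ord x)"
      using n by simp
    also have "z ^ (m mod ord x) = z ^ (ord x * (m div ord x) + m mod ord x)"
      unfolding power_add power_mult z by simp
    finally show ?case by simp
  next
    case (add P Q)
    then show ?case
      by (simp add: L_def gr_eval_add lookup_add distrib_right sum.distrib)
  qed
  then show ?thesis using eq by metis
qed

text \<open>The criterion by which units are shown to violate \<open>\<V>\<^sub>\<omega> = {1}\<close>: a unit of the group ring of a cyclic
group that lies in \<open>\<V>\<^sub>\<omega>\<close> equals \<open>1\<close>, and so do all its character values.\<close>
lemma gr_eval_unit_trivial:
  assumes triv: "units_omega G = {\<one>\<^bsub>group_ring G\<^esub>}"
    and x: "x \<in> carrier G" and n: "ord x > 0"
    and W: "cyc (ord x) dvd W * W' - 1" "gr_eval x (W - 1) \<in> aug_omega"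
    and z: "z ^ ord x = 1"
  shows "cpoly W z = 1"
proof -
  have inv: "gr_eval x (W * W') = gr_eval x 1"
    using gr_eval_cong[OF x _ W(1)] x by simp
  have "gr_eval x W \<in> units_omega G"
    using W(2) inv x by (intro units_omegaI[of _ "gr_eval x W'"])
      (auto simp: gr_eval_diff simp flip: gr_eval_mult, simp add: mult.commute)
  then have "gr_eval x W = gr_eval x 1" using triv by (simp add: gr_simps)
  then show ?thesis using gr_eval_eq_imp_cpoly_eq[OF x n z, of W 1] by simp
qed

text \<open>Let \<open>c\<close> be the value of the derivative of \<open>U\<close> at \<open>1\<close>. Modulo \<open>(x - 1)\<^sup>2\<close>, the unit \<open>U(x)\<close> is
\<open>1 + c(x - 1) \<equiv> x\<^sup>c\<close>. Hence \<open>U(x) x\<^sup>m\<close> lies in \<open>\<V>\<^sub>\<omega>\<close> if \<open>m \<equiv> -c\<close> modulo the order of \<open>x\<close>; being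
trivial, it shows that \<open>U(z)\<close> is a root of unity.\<close>
lemma cyclic_unit_root_of_unity:
  assumes triv: "units_omega G = {\<one>\<^bsub>group_ring G\<^esub>}"
    and x: "x \<in> carrier G" and n: "ord x > 0" and xx: "omega_pair x x"
    and U: "poly U 1 = 1" "cyc (ord x) dvd U * U' - 1"
    and z: "z ^ ord x = 1"
  shows "norm (cpoly U z) = 1"
proof -
  let ?n = "ord x"
  define e where "e = poly (pderiv U) 1"
  \<comment> \<open>With this \<open>m\<close>, the derivative of \<open>U X\<^sup>m\<close> at \<open>1\<close> is a multiple \<open>n q\<close> of the order; subtracting \<open>q (X\<^sup>n - 1)\<close> then leaves a double zero at \<open>1\<close>.\<close>
  define m where "m = nat ((- e) mod int ?n)"
  have "int m = (- e) mod int ?n"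
    using n by (simp add: m_def)
  then have "int ?n dvd e + int m"
    using mod_0_imp_dvd[of "e + int m" "int ?n"] by (simp add: mod_add_right_eq)
  then obtain q where q: "e + int m = int ?n * q" by (elim dvdE)
  define W where "W = U * monom 1 m"
  define R where "R = W - 1 - smult q (cyc ?n)"
  have "poly R 1 = 0"
    by (simp add: R_def W_def U poly_monom)
  then obtain R1 where R1: "R = cyc (Suc 0) * R1" using poly_one_root_iff by (metis dvdE)
  have "poly (pderiv R) 1 = 0"
    by (simp add: R_def W_def pderiv_diff pderiv_mult pderiv_smult pderiv_monom poly_monom U flip: e_def) (use q in \<open>simp add: algebra_simps\<close>)
  moreover have "poly (pderiv R) 1 = poly R1 1"
    unfolding R1 by (simp add: pderiv_mult pderiv_diff pderiv_monom poly_monom)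
  ultimately obtain R2 where R2: "R1 = cyc (Suc 0) * R2" using poly_one_root_iff by (metis dvdE)
  have "gr_eval x (W - 1) = gr_eval x R + frag_cmul q (gr_eval x (cyc ?n))"
    by (simp add: R_def gr_eval_diff gr_eval_smult)
  also have "\<dots> = gr_eval x (cyc (Suc 0)) \<star> gr_eval x (cyc (Suc 0)) \<star> gr_eval x R2"
    using x by (simp add: R1 R2 gr_eval_cyc gr_eval_mult gr_mult_assoc)
  also have "\<dots> \<in> aug_omega"
    using xx x aug_omega_closed(4)[of "gr_eval x (cyc (Suc 0)) \<star> gr_eval x (cyc (Suc 0))" "gr_eval x R2"]
    by (simp add: gr_eval_cyc omega_pair_def)
  finally have "gr_eval x (W - 1) \<in> aug_omega" .
  moreover have "cyc ?n dvd W * (U' * monom 1 ((?n - 1) * m)) - 1"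
  proof -
    have "W * (U' * monom 1 ((?n - 1) * m)) - 1 = (U * U') * (monom 1 m * monom 1 ((?n - 1) * m)) - 1"
      by (simp only: W_def mult_ac)
    also have "monom 1 m * monom 1 ((?n - 1) * m) = (monom 1 (?n * m) :: int poly)"
      using n by (simp add: mult_monom) (metis Suc_pred mult_Suc)
    also have "(U * U') * monom 1 (?n * m) - 1 = (U * U' - 1) * monom 1 (?n * m) + cyc (?n * m)"
      by (simp add: algebra_simps)
    finally show ?thesis using U(2) cyc_dvd_cyc_mult by (metis dvd_add dvd_mult2)
  qed
  ultimately have "cpoly W z = 1"
    using gr_eval_unit_trivial[OF triv x n] z by blast
  then have "norm (cpoly U z) * norm z ^ m = 1"
    by (simp add: W_def flip: norm_power norm_mult)
  moreover have "norm z = 1"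
    using power_eq_1_iff[OF z] n by simp
  ultimately show ?thesis by simp
qed

text \<open>The unit \<open>U(x) U(x\<^sup>e)\<^sup>-\<^sup>1 U(x\<^sup>f)\<^sup>-\<^sup>1\<close> lies in \<open>\<V>\<^sub>\<omega>\<close> by \<open>coprime_split_mem\<close>, applied to the ideal of those
polynomials whose value at \<open>x\<close> is in \<open>\<Delta>\<^sup>\<omega>\<close>. It is trivial, and a character evaluates it.\<close>
lemma coprime_unit_factors:
  assumes triv: "units_omega G = {\<one>\<^bsub>group_ring G\<^esub>}"
    and x: "x \<in> carrier G" and n: "ord x > 0" and pair: "omega_pair (x [^] e) (x [^] f)"
    and ef: "[e + f = 1] (mod ord x)"
    and U: "poly U 1 = 1" "cyc (ord x) dvd U * U' - 1"
    and z: "z ^ ord x = 1"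
  shows "cpoly U z = cpoly U (z ^ e) * cpoly U (z ^ f)"
proof -
  let ?n = "ord x"
  let ?e = "\<lambda>P. pcompose P (monom 1 e)" and ?f = "\<lambda>P. pcompose P (monom 1 f)"
  define W where "W = U * (?e U' * ?f U')"
  define W' where "W' = U' * (?e U * ?f U)"
  have inv: "cyc ?n dvd pcompose U (monom 1 m) * pcompose U' (monom 1 m) - 1" for m
  proof -
    obtain B where "U * U' - 1 = cyc ?n * B" using U(2) by (elim dvdE)
    then have "pcompose (U * U' - 1) (monom 1 m) = pcompose (cyc ?n * B) (monom 1 m)" by simp
    then have "pcompose U (monom 1 m) * pcompose U' (monom 1 m) - 1 = cyc (m * ?n) * pcompose B (monom 1 m)"
      by (simp add: pcompose_mult pcompose_diff pcompose_1 pcompose_monom_monom monom_one_power)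
    then show ?thesis using cyc_dvd_cyc_mult[of ?n m] by (metis dvd_mult2 mult.commute)
  qed
  have "gr_eval x (U * U') = frag_of \<one>" "gr_eval x (?e U * ?e U') = frag_of \<one>"
    "gr_eval x (?f U * ?f U') = frag_of \<one>"
    using gr_eval_cong[OF x pow_ord_eq_1[OF x]] U(2) inv by (metis gr_eval_1)+
  note ev = this
  define J where "J = {P. gr_eval x P \<in> aug_omega}"
  have "U - ?e U * ?f U \<in> J"
  proof (rule coprime_split_mem[where n = ?n])
    show "cyc ?n \<in> J" using x by (simp add: J_def gr_eval_cyc aug_omega_closed)
    show "cyc e * cyc f \<in> J"
      using x pair by (simp add: J_def gr_eval_mult gr_eval_cyc omega_pair_def)
    show "P + Q \<in> J" if "P \<in> J" "Q \<in> J" for P Q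
      using that by (simp add: J_def gr_eval_add aug_omega_closed)
    show "Q * P \<in> J" if "P \<in> J" for P Q
      using that x by (simp add: J_def gr_eval_mult aug_omega_closed)
  qed (use ef U in auto)
  then have "gr_eval x ((U - ?e U * ?f U) * (?e U' * ?f U')) \<in> aug_omega"
    using x by (simp add: J_def gr_eval_mult aug_omega_closed)
  moreover have "gr_eval x ((U - ?e U * ?f U) * (?e U' * ?f U')) = gr_eval x (W - 1)"
  proof -
    have "(U - ?e U * ?f U) * (?e U' * ?f U') = W - (?e U * ?e U') * (?f U * ?f U')"
      by (simp add: W_def algebra_simps)
    then show ?thesis using x ev by (simp add: gr_eval_diff gr_eval_mult[of x "?e U * ?e U'" "?f U * ?f U'"])
  qed
  ultimately have "gr_eval x (W - 1) \<in> aug_omega" by simp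
  moreover have "cyc ?n dvd W * W' - 1"
  proof -
    have *: "cyc ?n dvd A * B - 1" if "cyc ?n dvd A - 1" "cyc ?n dvd B - 1" for A B
    proof -
      have "A * B - 1 = (A - 1) * B + (B - 1)" by (simp add: algebra_simps)
      then show ?thesis using that by (metis dvd_add dvd_mult2)
    qed
    have "W * W' - 1 = (U * U') * ((?e U * ?e U') * (?f U * ?f U')) - 1"
      by (simp only: W_def W'_def mult_ac)
    then show ?thesis using * inv U(2) by metis
  qed
  ultimately have "cpoly W z = 1"
    using gr_eval_unit_trivial[OF triv x n] z by blast
  have "cpoly (pcompose U (monom 1 m)) z * cpoly (pcompose U' (monom 1 m)) z = 1" for m
  proof -
    obtain B where "pcompose U (monom 1 m) * pcompose U' (monom 1 m) - 1 = cyc ?n * B"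
      using inv[of m] by (elim dvdE)
    from arg_cong[OF this, of "\<lambda>P. cpoly P z"] have "cpoly (pcompose U (monom 1 m) * pcompose U' (monom 1 m) - 1) z = cpoly (cyc ?n * B) z" .
    then show ?thesis using z by simp
  qed
  from this[of e] this[of f] have "cpoly U (z ^ e) * cpoly U' (z ^ e) = 1" "cpoly U (z ^ f) * cpoly U' (z ^ f) = 1"
    by simp_all
  note inv_e = this(1) and inv_f = this(2)
  have "cpoly U z = cpoly U z * (cpoly U (z ^ e) * cpoly U' (z ^ e)) * (cpoly U (z ^ f) * cpoly U' (z ^ f))"
    unfolding inv_e inv_f by simp
  also have "\<dots> = cpoly W z * (cpoly U (z ^ e) * cpoly U (z ^ f))"
    by (simp add: W_def mult_ac)
  finally show ?thesis using \<open>cpoly W z = 1\<close> by simp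
qed

end

section \<open>Absolute values of Bass units at roots of unity\<close>

lemma norm_cis_minus_one: "(norm (cis t - 1))\<^sup>2 = 2 - 2 * cos t"
proof -
  have "(cos t - 1)\<^sup>2 + (sin t)\<^sup>2 = 2 - 2 * cos t"
    using sin_cos_squared_add[of t] by (simp add: power2_eq_square algebra_simps)
  then show ?thesis by (simp add: cmod_power2)
qed

lemma norm_cis_plus_one: "(norm (cis t + 1))\<^sup>2 = 2 + 2 * cos t"
proof -
  have "(cos t + 1)\<^sup>2 + (sin t)\<^sup>2 = 2 + 2 * cos t"
    using sin_cos_squared_add[of t] by (simp add: power2_eq_square algebra_simps)
  then show ?thesis by (simp add: cmod_power2)
qed

lemma root_power_cong:
  assumes "(z::complex) ^ n = 1" "[i = j] (mod n)"
  shows "z ^ i = z ^ j"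
proof -
  have "z ^ m = z ^ (m mod n)" for m
  proof -
    have "z ^ m = z ^ (n * (m div n) + m mod n)" by simp
    also have "\<dots> = z ^ (m mod n)" unfolding power_add power_mult assms(1) by simp
    finally show ?thesis .
  qed
  then show ?thesis using assms(2) unfolding cong_def by metis
qed

lemma primitive_root_cis:
  assumes "n > 1"
  shows "cis (2 * pi / n) ^ n = 1" "cis (2 * pi / n) \<noteq> 1"
proof -
  show "cis (2 * pi / n) ^ n = 1" using assms by (simp add: Complex.DeMoivre)
  have "cos (2 * pi / n) \<noteq> 1"
  proof (cases "n = 2")
    case False
    then have "0 < 2 * pi / n" "2 * pi / n \<le> pi" using assms by (simp_all add: field_simps)
    then show ?thesis using cos_monotone_0_pi[of 0 "2 * pi / n"] by simp
  qed simp
  then show "cis (2 * pi / n) \<noteq> 1" by (metis cis.sel(1) one_complex.sel(1))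
qed

context group
begin

text \<open>On the upper half circle the distance to \<open>1\<close> grows with the angle, so \<open>|\<zeta>\<^sup>k - 1| > |\<zeta> - 1|\<close> for
\<open>\<zeta> = exp(2\<pi>i/n)\<close>, and the Bass unit with parameter \<open>k\<close> does not have absolute value \<open>1\<close> at \<open>\<zeta>\<close>.\<close>
lemma omega_pair_self_bound:
  assumes triv: "units_omega G = {\<one>\<^bsub>group_ring G\<^esub>}"
    and x: "x \<in> carrier G" and xx: "omega_pair x x"
    and k: "coprime k (ord x)" "1 < k" "2 * k \<le> ord x"
  shows False
proof -
  define n where "n = ord x"
  have n: "n > 1" using k by (simp add: n_def)
  obtain U U' r where U: "r > 0" "poly U 1 = 1" "cyc n dvd U * U' - 1"
    "\<And>z. z ^ n = 1 \<Longrightarrow> z \<noteq> 1 \<Longrightarrow> (z - 1) ^ r * cpoly U z = (z ^ k - 1) ^ r"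
    using bass_unit[OF n] k(1) by (metis n_def)
  define t where "t = 2 * pi / n"
  define z where "z = cis t"
  have z: "z ^ n = 1" "z \<noteq> 1" using primitive_root_cis[OF n] by (simp_all add: z_def t_def)
  have "norm (cpoly U z) = 1"
    using cyclic_unit_root_of_unity[OF triv x _ xx U(2), of U' z] U(3) z n by (simp add: n_def)
  then have "norm (z - 1) ^ r = norm (z ^ k - 1) ^ r"
    using arg_cong[OF U(4)[OF z], of norm] by (simp add: norm_mult norm_power)
  then have "norm (z - 1) = norm (z ^ k - 1)"
    using U(1) by (simp add: power_eq_iff_eq_base)
  then have "cos t = cos (real k * t)"
    using norm_cis_minus_one[of t] norm_cis_minus_one[of "real k * t"] by (simp add: z_def Complex.DeMoivre)
  moreover have t: "0 < t"
    using n by (simp add: t_def)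
  moreover have "t < real k * t"
    using mult_strict_right_mono[of 1 "real k" t] t k(2) by simp
  moreover have "real k * t \<le> pi"
  proof -
    have "real (2 * k) \<le> real n" using k(3) unfolding n_def by (rule of_nat_mono)
    then have "real (2 * k) * pi \<le> real n * pi" by (intro mult_right_mono) auto
    then show ?thesis using n by (simp add: t_def field_simps)
  qed
  ultimately show False using cos_monotone_0_pi[of t "real k * t"] by simp
qed

text \<open>A prime power above \<open>4\<close> is odd and at least \<open>5\<close>, or at least \<open>8\<close> and prime to \<open>3\<close>: the Bass units with
parameters \<open>2\<close> and \<open>3\<close> apply.\<close>
lemma prime_power_omega_pair_self:
  assumes triv: "units_omega G = {\<one>\<^bsub>group_ring G\<^esub>}"
    and x: "x \<in> carrier G" and xx: "omega_pair x x"
    and p: "Factorial_Ring.prime p" "ord x = p ^ m"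
  shows "ord x \<le> 4"
proof (rule ccontr)
  assume big: "\<not> ord x \<le> 4"
  show False
  proof (cases "p = 2")
    case True
    have "m \<ge> 3"
    proof (rule ccontr)
      assume "\<not> m \<ge> 3"
      then have "m \<in> {0, 1, 2}" by auto
      then show False using big p True by auto
    qed
    then have "(2::nat) ^ 3 \<le> 2 ^ m" by (intro power_increasing) auto
    then have "8 \<le> ord x" using p True by simp
    moreover have "coprime 3 (ord x)" using p True by simp
    ultimately show False using omega_pair_self_bound[OF triv x xx, of 3] by simp
  next
    case False
    then have "odd p" using p(1) primes_dvd_imp_eq two_is_prime_nat by blast
    then have "coprime 2 (ord x)" using p by simp
    then show False using omega_pair_self_bound[OF triv x xx, of 2] big by simp
  qed
qed

text \<open>The product \<open>x = gh\<close> generates the direct product of the two cyclic groups; \<open>e\<close> and \<open>f\<close> come from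
the Chinese remainder theorem, so that \<open>x\<^sup>e = g\<close> and \<open>x\<^sup>f = h\<close>.\<close>
lemma coprime_orders_unit_factors:
  assumes triv: "units_omega G = {\<one>\<^bsub>group_ring G\<^esub>}"
    and g: "g \<in> carrier G" and h: "h \<in> carrier G" and cop: "coprime (ord g) (ord h)"
    and pos: "ord g > 0" "ord h > 0"
    and U: "poly U 1 = 1" "cyc (ord g * ord h) dvd U * U' - 1"
    and u: "u ^ ord g = 1" and v: "v ^ ord h = 1"
  shows "cpoly U (u * v) = cpoly U u * cpoly U v"
proof -
  define a b where "a = ord g" and "b = ord h"
  have pair: "omega_pair g h"
    using omega_pair_coprime[OF g pow_ord_eq_1[OF g] h pow_ord_eq_1[OF h] cop] .
  have comm: "g \<otimes> h = h \<otimes> g"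
    by (rule omega_pair_commute[OF triv g h pair])
  define x where "x = g \<otimes> h"
  have x: "x \<in> carrier G" using g h by (simp add: x_def)
  have xpow: "x [^] m = g [^] m \<otimes> h [^] m" for m :: nat
    unfolding x_def by (rule pow_mult_distrib[OF comm g h])
  obtain e where e: "[e = 1] (mod a)" "[e = 0] (mod b)"
    using binary_chinese_remainder_nat[of a b 1 0] cop unfolding a_def b_def by blast
  obtain f where f: "[f = 0] (mod a)" "[f = 1] (mod b)"
    using binary_chinese_remainder_nat[of a b 0 1] cop unfolding a_def b_def by blast
  have pow_cong: "y [^] i = y [^] j" if "y \<in> carrier G" "[i = j] (mod ord y)" for y and i j :: nat
  proof -
    have "[int i = int j] (mod int (ord y))" using that by (simp add: cong_int_iff)
    then have "int (ord y) dvd int j - int i" by (metis cong_iff_dvd_diff cong_sym)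
    then show ?thesis using that int_pow_eq[of y "int i" "int j"] by (simp only: int_pow_int)
  qed
  have xe: "x [^] e = g"
    using pow_cong[OF g e(1)[unfolded a_def]] pow_cong[OF h e(2)[unfolded b_def]] g h by (simp add: xpow)
  have xf: "x [^] f = h"
    using pow_cong[OF g f(1)[unfolded a_def]] pow_cong[OF h f(2)[unfolded b_def]] g h by (simp add: xpow)
  have ord: "ord x = a * b"
  proof (subst ord_unique[OF x], intro allI iffI)
    fix m :: nat assume "x [^] m = \<one>"
    then have "(x [^] m) [^] e = \<one>" "(x [^] m) [^] f = \<one>" by simp_all
    then have "(x [^] e) [^] m = \<one>" "(x [^] f) [^] m = \<one>"
      using x by (simp_all add: nat_pow_pow mult.commute)
    then have "a dvd m" "b dvd m"
      unfolding xe xf using g h by (simp_all add: pow_eq_id a_def b_def)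
    then show "a * b dvd m" using cop by (simp add: a_def b_def divides_mult)
  next
    fix m :: nat assume "a * b dvd m"
    then have "a dvd m" "b dvd m" by (auto dest: dvd_mult_left dvd_mult_right)
    then have "g [^] m = \<one>" "h [^] m = \<one>" using g h by (simp_all add: pow_eq_id a_def b_def)
    then show "x [^] m = \<one>" by (simp add: xpow)
  qed
  have ef: "[e + f = 1] (mod ord x)"
  proof -
    have "[e + f = 1 + 0] (mod a)" "[e + f = 0 + 1] (mod b)"
      using e f by (intro cong_add; simp)+
    then show ?thesis
      unfolding ord using coprime_cong_mult_nat[of "e + f" 1 a b] cop by (simp add: a_def b_def)
  qed
  have uv: "(u * v) ^ ord x = 1"
  proof -
    have "(u * v) ^ ord x = (u ^ a) ^ b * (v ^ b) ^ a"
      unfolding ord by (simp add: power_mult_distrib power_mult[symmetric] mult.commute)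
    then show ?thesis using u v by (simp add: a_def b_def)
  qed
  have "cpoly U (u * v) = cpoly U ((u * v) ^ e) * cpoly U ((u * v) ^ f)"
  proof (rule coprime_unit_factors[OF triv x _ _ ef U(1) _ uv])
    show "0 < ord x" using pos by (simp add: ord a_def b_def)
    show "omega_pair (x [^] e) (x [^] f)" unfolding xe xf by (rule pair)
    show "cyc (ord x) dvd U * U' - 1" using U(2) by (simp add: ord a_def b_def)
  qed
  moreover have "(u * v) ^ e = u" "(u * v) ^ f = v"
    using root_power_cong[OF u e(1)[unfolded a_def]] root_power_cong[OF v e(2)[unfolded b_def]]
      root_power_cong[OF u f(1)[unfolded a_def]] root_power_cong[OF v f(2)[unfolded b_def]]
    by (simp_all add: power_mult_distrib)
  ultimately show ?thesis by simp
qed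

text \<open>Take the Bass unit whose parameter \<open>k\<close> is \<open>1\<close> modulo the order of \<open>g\<close> and \<open>-1\<close> modulo the order of
\<open>h\<close>. It has absolute value \<open>1\<close> at the roots of unity \<open>u = exp(i s)\<close> and \<open>v = exp(i t)\<close>, hence at
\<open>uv\<close>; this means \<open>|exp(i(s + t)) - 1| = |exp(i(s - t)) - 1|\<close>, that is \<open>sin s sin t = 0\<close>, which is
false for angles strictly between \<open>0\<close> and \<open>\<pi>\<close>.\<close>
lemma coprime_orders_gt_two:
  assumes triv: "units_omega G = {\<one>\<^bsub>group_ring G\<^esub>}"
    and g: "g \<in> carrier G" and h: "h \<in> carrier G" and cop: "coprime (ord g) (ord h)"
    and gt: "ord g > 2" "ord h > 2"
  shows False
proof -
  define a b where "a = ord g" and "b = ord h"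
  obtain k where k: "[k = 1] (mod a)" "[k = b - 1] (mod b)"
    using binary_chinese_remainder_nat[of a b 1 "b - 1"] cop unfolding a_def b_def by blast
  have "coprime k a" using k(1) by (metis cong_imp_coprime cong_sym coprime_1_left)
  moreover have "coprime k b"
    using k(2) gt(2) coprime_diff_one_left_nat[of b] cong_imp_coprime[OF cong_sym[OF k(2)]] by (simp add: b_def)
  ultimately have "coprime k (a * b)" by simp
  moreover have "1 < a * b" using mult_le_mono[of 3 a 3 b] gt by (simp add: a_def b_def)
  ultimately obtain U U' r where U: "r > 0" "poly U 1 = 1" "cyc (a * b) dvd U * U' - 1"
    "\<And>z. z ^ (a * b) = 1 \<Longrightarrow> z \<noteq> 1 \<Longrightarrow> (z - 1) ^ r * cpoly U z = (z ^ k - 1) ^ r"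
    using bass_unit by metis
  define s t where "s = 2 * pi / a" and "t = 2 * pi / b"
  define u v where "u = cis s" and "v = cis t"
  have u: "u ^ a = 1" "u \<noteq> 1" using primitive_root_cis[of a] gt by (simp_all add: u_def s_def a_def)
  have v: "v ^ b = 1" "v \<noteq> 1" using primitive_root_cis[of b] gt by (simp_all add: v_def t_def b_def)
  have uk: "u ^ k = u" using root_power_cong[OF u(1) k(1)] by simp
  have vk: "v ^ k = cis (- t)"
  proof -
    have "v ^ k * v = v ^ b"
      using root_power_cong[OF v(1) k(2)] gt(2) by (simp add: b_def flip: power_Suc2)
    moreover have "v * cis (- t) = 1" by (simp add: v_def cis_mult)
    ultimately show ?thesis using v(1) by (metis mult.assoc mult_1 mult.right_neutral)
  qed
  have "cpoly U u = 1"
    using U(4)[of u] u uk by (simp add: power_mult)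
  have s: "0 < s" "s < pi" and t: "0 < t" "t < pi"
    using gt by (simp_all add: s_def t_def a_def b_def field_simps)
  have v_root: "v ^ (a * b) = 1"
    using v by (metis mult.commute power_mult power_one)
  have uv: "(u * v) ^ (a * b) = 1"
    using u v v_root by (simp add: power_mult_distrib power_mult)
  have ns: "norm (v - 1) = norm (v ^ k - 1)"
  proof (rule power2_eq_imp_eq)
    show "(norm (v - 1))\<^sup>2 = (norm (v ^ k - 1))\<^sup>2"
      unfolding vk by (simp add: v_def norm_cis_minus_one)
  qed auto
  then have "norm (cpoly U v) = 1"
    using arg_cong[OF U(4)[OF v_root v(2)], of norm] v(2)
    by (simp add: norm_mult norm_power flip: ns)
  moreover have "cpoly U (u * v) = cpoly U u * cpoly U v"
    using coprime_orders_unit_factors[OF triv g h cop _ _ U(2)] U(3) u v gt by (simp add: a_def b_def)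
  ultimately have n1: "norm (cpoly U (u * v)) = 1" using \<open>cpoly U u = 1\<close> by simp
  have neq: "u * v \<noteq> 1"
  proof
    assume "u * v = 1"
    then have 1: "cos (s + t) = 1"
      by (simp add: u_def v_def cis_mult complex_eq_iff)
    have "2 * ((s + t) / 2) = s + t" by (simp add: field_simps)
    then have "cos (s + t) = 1 - 2 * (sin ((s + t) / 2))\<^sup>2"
      using cos_double_sin[of "(s + t) / 2"] by metis
    with 1 have "sin ((s + t) / 2) = 0" by simp
    moreover have "0 < sin ((s + t) / 2)" using s t by (intro sin_gt_zero) auto
    ultimately show False by simp
  qed
  have "norm (u * v - 1) ^ r = norm ((u * v) ^ k - 1) ^ r"
    using arg_cong[OF U(4)[OF uv neq], of norm] n1 by (simp add: norm_mult norm_power)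
  then have "norm (u * v - 1) = norm ((u * v) ^ k - 1)"
    using U(1) by (simp add: power_eq_iff_eq_base)
  then have "norm (cis (s + t) - 1) = norm (cis (s - t) - 1)"
    by (simp add: power_mult_distrib uk vk) (simp add: u_def v_def cis_mult)
  then have "cos (s + t) = cos (s - t)"
    using norm_cis_minus_one[of "s + t"] norm_cis_minus_one[of "s - t"] by simp
  then have "sin s * sin t = 0" by (simp add: cos_add cos_diff)
  then show False using s t sin_gt_zero[of s] sin_gt_zero[of t] by auto
qed

text \<open>Now the character of \<open>\<langle>g\<rangle>\<close> takes the value \<open>-1\<close>, and the Bass unit with odd parameter \<open>k \<equiv> -2\<close> modulo
the order of \<open>h\<close> is \<open>1\<close> at \<open>-1\<close>. Therefore it has the same value at \<open>v = exp(i t)\<close> and at \<open>-v\<close>.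
Comparing absolute values gives \<open>cos(2t) = cos t\<close>, impossible for \<open>t = 2\<pi>/b\<close> with \<open>b \<ge> 5\<close>.\<close>
lemma order_two_coprime_order:
  assumes triv: "units_omega G = {\<one>\<^bsub>group_ring G\<^esub>}"
    and g: "g \<in> carrier G" and h: "h \<in> carrier G"
    and ord: "ord g = 2" "odd (ord h)" "ord h \<ge> 5"
  shows False
proof -
  define b where "b = ord h"
  have b: "odd b" "b \<ge> 5" using ord by (simp_all add: b_def)
  have cop: "coprime (ord g) (ord h)" using ord by simp
  obtain k where k: "[k = 1] (mod 2)" "[k = b - 2] (mod b)"
    using binary_chinese_remainder_nat[of 2 b 1 "b - 2"] b by auto
  have "coprime (b - 2) b"
  proof -
    have "coprime (b - 2) 2" using b by simp
    then have "coprime (b - 2) (b - 2 + 2)" by (simp only: coprime_iff_gcd_eq_1 gcd_add2)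
    moreover have "b - 2 + 2 = b" using b by linarith
    ultimately show ?thesis by (simp only:)
  qed
  then have "coprime k b" using cong_imp_coprime[OF cong_sym[OF k(2)]] by simp
  moreover have "coprime k 2" using k(1) by (metis cong_imp_coprime cong_sym coprime_1_left)
  ultimately have "coprime k (2 * b)" by simp
  moreover have "1 < 2 * b" using b by simp
  ultimately obtain U U' r where U: "r > 0" "poly U 1 = 1" "cyc (2 * b) dvd U * U' - 1"
    "\<And>z. z ^ (2 * b) = 1 \<Longrightarrow> z \<noteq> 1 \<Longrightarrow> (z - 1) ^ r * cpoly U z = (z ^ k - 1) ^ r"
    using bass_unit by metis
  define t where "t = 2 * pi / b"
  define v where "v = cis t"
  have v: "v ^ b = 1" "v \<noteq> 1" using primitive_root_cis[of b] b by (simp_all add: v_def t_def)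
  have t: "0 < t" "2 * t \<le> pi"
    using b by (simp_all add: t_def field_simps)
  have m1: "(- 1 :: complex) ^ k = - 1" using root_power_cong[of "- 1" 2 k 1] k(1) by simp
  have vk: "v ^ k = cis (- (2 * t))"
  proof -
    have "v ^ k * v ^ 2 = v ^ b"
      unfolding root_power_cong[OF v(1) k(2)] power_add[symmetric] le_add_diff_inverse2[of 2 b]
      using b by (subst le_add_diff_inverse2) simp_all
    moreover have "v ^ 2 * cis (- (2 * t)) = 1" by (simp add: v_def Complex.DeMoivre cis_mult)
    ultimately show ?thesis using v(1) by (metis mult.assoc mult_1 mult.right_neutral)
  qed
  have "cpoly U (- 1) = 1"
    using U(4)[of "- 1"] m1 by (simp add: power_mult)
  moreover have "cpoly U (- 1 * v) = cpoly U (- 1) * cpoly U v"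
    using coprime_orders_unit_factors[OF triv g h cop _ _ U(2), of U' "- 1" v] U(3) v ord by (simp add: b_def)
  ultimately have Uv: "cpoly U (- v) = cpoly U v" by simp
  have v2: "v ^ (2 * b) = 1" using v by (metis mult.commute power_mult power_one)
  have "- v \<noteq> 1"
  proof
    assume "- v = 1"
    then have "v = - 1" by (metis minus_equation_iff)
    then show False using v(1) b by simp
  qed
  have "(norm (v - 1)) ^ r * norm (cpoly U v) = (norm (cis (- (2 * t)) - 1)) ^ r"
    using arg_cong[OF U(4)[OF v2 v(2)], of norm] by (simp add: norm_mult norm_power vk)
  moreover have "(norm (v + 1)) ^ r * norm (cpoly U v) = (norm (cis (- (2 * t)) + 1)) ^ r"
  proof -
    have "(- v) ^ k = - cis (- (2 * t))"
      using m1 vk power_mult_distrib[of "- 1" v k] by simp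
    then have "(- v - 1) ^ r * cpoly U v = (- cis (- (2 * t)) - 1) ^ r"
      using U(4)[of "- v"] v2 \<open>- v \<noteq> 1\<close> Uv by (simp add: power_mult)
    from arg_cong[OF this, of norm] show ?thesis
      using norm_minus_cancel[of "v + 1"] norm_minus_cancel[of "cis (- (2 * t)) + 1"]
      by (simp add: norm_mult norm_power)
  qed
  ultimately have "(norm (v - 1) * norm (cis (- (2 * t)) + 1)) ^ r = (norm (v + 1) * norm (cis (- (2 * t)) - 1)) ^ r"
    unfolding power_mult_distrib by (metis mult.assoc mult.commute)
  then have "norm (v - 1) * norm (cis (- (2 * t)) + 1) = norm (v + 1) * norm (cis (- (2 * t)) - 1)"
    using U(1) by (simp add: power_eq_iff_eq_base)
  then have "(norm (v - 1))\<^sup>2 * (norm (cis (- (2 * t)) + 1))\<^sup>2 = (norm (v + 1))\<^sup>2 * (norm (cis (- (2 * t)) - 1))\<^sup>2"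
    by (metis power_mult_distrib)
  then have "(2 - 2 * cos t) * (2 + 2 * cos (2 * t)) = (2 + 2 * cos t) * (2 - 2 * cos (2 * t))"
    unfolding v_def norm_cis_minus_one norm_cis_plus_one by simp
  then have "cos (2 * t) = cos t" by (simp add: algebra_simps)
  then show False using cos_monotone_0_pi[of t "2 * t"] t by simp
qed

end

section \<open>Commutators and the lower central series\<close>

context group
begin

abbreviation comm :: "'a \<Rightarrow> 'a \<Rightarrow> 'a"
  where "comm x y \<equiv> x \<otimes> y \<otimes> inv x \<otimes> inv y"

lemma comm_eq_iff:
  assumes "x \<in> carrier G" "y \<in> carrier G" "z \<in> carrier G"
  shows "comm x y = z \<longleftrightarrow> x \<otimes> y = z \<otimes> (y \<otimes> x)"
proof -
  have "comm x y = x \<otimes> y \<otimes> inv (y \<otimes> x)"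
    using assms by (simp add: inv_mult_group m_assoc)
  then show ?thesis
    using assms by (metis inv_solve_right m_closed inv_closed)
qed

lemma comm_eq_one_iff:
  "x \<in> carrier G \<Longrightarrow> y \<in> carrier G \<Longrightarrow> comm x y = \<one> \<longleftrightarrow> x \<otimes> y = y \<otimes> x"
  by (simp add: comm_eq_iff)

lemma comm_power_left:
  assumes x: "x \<in> carrier G" and y: "y \<in> carrier G" and z: "z \<in> carrier G"
    and xy: "x \<otimes> y = z \<otimes> (y \<otimes> x)" and zx: "z \<otimes> x = x \<otimes> z"
  shows "x [^] (r::nat) \<otimes> y = z [^] r \<otimes> (y \<otimes> x [^] r)"
proof (induction r)
  case 0
  then show ?case using y by simp
next
  case (Suc r)
  have zr: "x [^] r \<otimes> z = z \<otimes> x [^] r"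
    using x z zx by (metis nat_pow_comm nat_pow_eone group_commutes_pow)
  have "x [^] Suc r \<otimes> y = x [^] r \<otimes> z \<otimes> (y \<otimes> x)"
    using x y z xy by (simp add: m_assoc)
  also have "\<dots> = z \<otimes> (x [^] r \<otimes> y) \<otimes> x"
    using x y z zr by (simp add: m_assoc)
  also have "\<dots> = (z \<otimes> z [^] r) \<otimes> (y \<otimes> (x [^] r \<otimes> x))"
    unfolding Suc using x y z by (simp add: m_assoc)
  finally show ?case using z nat_pow_Suc2[OF z, of r] by simp
qed

text \<open>\<open>comm_power_left\<close> gives the power of the left argument; inverting the commutator exchanges the two
arguments, so it also gives the power of the right one.\<close>
lemma comm_power_central:
  assumes x: "x \<in> carrier G" and y: "y \<in> carrier G"
    and zx: "comm x y \<otimes> x = x \<otimes> comm x y" and zy: "comm x y \<otimes> y = y \<otimes> comm x y"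
  shows "comm (x [^] (r::nat)) (y [^] (s::nat)) = comm x y [^] (r * s)"
proof -
  define z where "z = comm x y"
  have z: "z \<in> carrier G" using x y by (simp add: z_def)
  have xy: "x \<otimes> y = z \<otimes> (y \<otimes> x)" using comm_eq_iff[OF x y z] by (simp add: z_def)
  define u q where "u = x [^] r" and "q = z [^] r"
  have u: "u \<in> carrier G" and q: "q \<in> carrier G" using x z by (simp_all add: u_def q_def)
  have uy: "u \<otimes> y = q \<otimes> (y \<otimes> u)"
    unfolding u_def q_def using comm_power_left[OF x y z xy] zx by (simp add: z_def)
  have qy: "q \<otimes> y = y \<otimes> q"
    unfolding q_def using y z zy by (metis group_commutes_pow z_def)
  have "inv q \<otimes> (u \<otimes> y) = y \<otimes> u"
    unfolding uy using u q y by (simp add: inv_solve_left')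
  then have yu: "y \<otimes> u = inv q \<otimes> (u \<otimes> y)" ..
  have "inv q \<otimes> y = y \<otimes> inv q"
    using q y qy by (metis inv_closed inv_solve_left inv_solve_right m_assoc m_closed)
  then have "y [^] s \<otimes> u = inv q [^] s \<otimes> (u \<otimes> y [^] s)"
    using comm_power_left[OF y u _ yu] q by simp
  then have "comm (y [^] s) u = inv q [^] s"
    using comm_eq_iff[of "y [^] s" u "inv q [^] s"] u q y by simp
  moreover have "comm u (y [^] s) = inv (comm (y [^] s) u)"
    using u y by (simp add: inv_mult_group m_assoc)
  ultimately have "comm u (y [^] s) = q [^] s"
    using q by (simp add: nat_pow_inv)
  then show ?thesis
    using z by (simp add: u_def q_def z_def nat_pow_pow)
qed

text \<open>Statements modulo \<open>N\<close> become equations in a group through this homomorphism, without any reference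
to cosets.\<close>
lemma normal_is_kernel:
  assumes "N \<lhd> G"
  obtains Q :: "'a set monoid" and h where "group_hom G Q h" "\<And>a. a \<in> carrier G \<Longrightarrow> a \<in> N \<longleftrightarrow> h a = \<one>\<^bsub>Q\<^esub>"
proof -
  interpret N: normal N G by (rule assms)
  interpret Q: group "G Mod N" by (rule N.factorgroup_is_group)
  have "group_hom G (G Mod N) (\<lambda>a. N #> a)"
    by unfold_locales (rule N.r_coset_hom_Mod)
  moreover have "a \<in> N \<longleftrightarrow> N #> a = \<one>\<^bsub>G Mod N\<^esub>" if "a \<in> carrier G" for a
    using that coset_join1[OF _ that N.subgroup_axioms] coset_join2[OF that N.subgroup_axioms]
    by (auto simp: FactGroup_def)
  ultimately show ?thesis using that by blast
qed

text \<open>In the quotient by \<open>N\<close> the commutator is central, and \<open>comm_power_central\<close> applies.\<close>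
lemma comm_power_mod:
  assumes N: "N \<lhd> G" and x: "x \<in> carrier G" and y: "y \<in> carrier G"
    and central: "\<And>h. h \<in> carrier G \<Longrightarrow> comm (comm x y) h \<in> N"
  shows "comm (x [^] (r::nat)) (y [^] (s::nat)) \<in> N \<longleftrightarrow> comm x y [^] (r * s) \<in> N"
proof -
  obtain Q :: "'a set monoid" and \<phi> where \<phi>: "group_hom G Q \<phi>"
    and mem: "\<And>a. a \<in> carrier G \<Longrightarrow> a \<in> N \<longleftrightarrow> \<phi> a = \<one>\<^bsub>Q\<^esub>"
    using normal_is_kernel[OF N] by metis
  interpret h: group_hom G Q \<phi> by (rule \<phi>)
  have commutes: "h.H.comm (\<phi> x) (\<phi> y) \<otimes>\<^bsub>Q\<^esub> \<phi> a = \<phi> a \<otimes>\<^bsub>Q\<^esub> h.H.comm (\<phi> x) (\<phi> y)"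
    if "a \<in> carrier G" for a
  proof -
    have "h.H.comm (\<phi> (comm x y)) (\<phi> a) = \<one>\<^bsub>Q\<^esub>"
      using that x y central[OF that] mem[of "comm (comm x y) a"] by simp
    then have "\<phi> (comm x y) \<otimes>\<^bsub>Q\<^esub> \<phi> a = \<phi> a \<otimes>\<^bsub>Q\<^esub> \<phi> (comm x y)"
      using that x y by (subst (asm) h.H.comm_eq_one_iff) auto
    then show ?thesis using x y by simp
  qed
  have "\<phi> (comm (x [^] r) (y [^] s)) = h.H.comm (\<phi> x [^]\<^bsub>Q\<^esub> r) (\<phi> y [^]\<^bsub>Q\<^esub> s)"
    using x y by (simp add: h.hom_nat_pow)
  also have "\<dots> = h.H.comm (\<phi> x) (\<phi> y) [^]\<^bsub>Q\<^esub> (r * s)"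
    using commutes x y by (intro h.H.comm_power_central) auto
  also have "\<dots> = \<phi> (comm x y [^] (r * s))"
    using x y by (simp add: h.hom_nat_pow)
  finally show ?thesis using mem x y by simp
qed

lemma lower_central_normal: "lower_central G n \<lhd> G"
proof -
  have "lower_central G (Suc m) \<lhd> G" for m
  proof (induction m)
    case 0
    show ?case by (simp add: normal_inv_iff subgroup_self)
  next
    case (Suc m)
    interpret L: normal "lower_central G (Suc m)" G by (rule Suc)
    show ?case
      unfolding lower_central.simps(3)
    proof (rule normal_generateI)
      fix h g assume h: "h \<in> {comm x y |x y. x \<in> lower_central G (Suc m) \<and> y \<in> carrier G}"
        and g: "g \<in> carrier G"
      then obtain x y where xy: "h = comm x y" "x \<in> lower_central G (Suc m)" "y \<in> carrier G" by blast
      have x: "x \<in> carrier G" using L.subset xy(2) by blast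
      have "inv g \<otimes> (g \<otimes> a) = a" if "a \<in> carrier G" for a
        using that g by (simp flip: m_assoc)
      then have "g \<otimes> h \<otimes> inv g = comm (g \<otimes> x \<otimes> inv g) (g \<otimes> y \<otimes> inv g)"
        using x xy g by (simp add: inv_mult_group m_assoc)
      moreover have "g \<otimes> x \<otimes> inv g \<in> lower_central G (Suc m)"
        using xy g L.inv_op_closed2 by blast
      ultimately show "g \<otimes> h \<otimes> inv g \<in> {comm x y |x y. x \<in> lower_central G (Suc m) \<and> y \<in> carrier G}"
        using g xy by auto
    qed auto
  qed
  then show ?thesis by (cases n) (auto simp: normal_inv_iff subgroup_self)
qed

lemma lower_central_subset: "lower_central G n \<subseteq> carrier G"
  using normal_imp_subgroup[OF lower_central_normal] by (rule subgroup.subset)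

lemma lower_central_carrier: "x \<in> lower_central G n \<Longrightarrow> x \<in> carrier G"
  using lower_central_subset by blast

lemma comm_lower_central:
  "x \<in> lower_central G (Suc n) \<Longrightarrow> y \<in> carrier G \<Longrightarrow> comm x y \<in> lower_central G (Suc (Suc n))"
  unfolding lower_central.simps(3) by (blast intro: generate.incl)

lemma lower_central_trivial_mono:
  assumes "lower_central G (Suc c) = {\<one>}"
  shows "lower_central G (Suc (c + i)) = {\<one>}"
proof (induction i)
  case 0
  then show ?case using assms by simp
next
  case (Suc i)
  have "{comm x y |x y. x \<in> lower_central G (Suc (c + i)) \<and> y \<in> carrier G} \<subseteq> {\<one>}"
    unfolding Suc by auto
  then have "lower_central G (Suc (Suc (c + i))) \<subseteq> {\<one>}"
    unfolding lower_central.simps(3) by (rule generate_subgroup_incl) (rule triv_subgroup)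
  moreover have "\<one> \<in> lower_central G (Suc (Suc (c + i)))"
    by (simp add: generate.one)
  ultimately show ?case by auto
qed

lemma lower_central_subgroup_mono:
  assumes "subgroup H G"
  shows "lower_central (G\<lparr>carrier := H\<rparr>) n \<subseteq> lower_central G n"
proof -
  interpret H: subgroup H G by (rule assms)
  interpret HG: group "G\<lparr>carrier := H\<rparr>" using subgroup_imp_group[OF assms] .
  have "lower_central (G\<lparr>carrier := H\<rparr>) (Suc m) \<subseteq> lower_central G (Suc m)" for m
  proof (induction m)
    case 0
    then show ?case by auto
  next
    case (Suc m)
    have sub: "{HG.comm x y |x y. x \<in> lower_central (G\<lparr>carrier := H\<rparr>) (Suc m) \<and> y \<in> H}
        \<subseteq> {comm x y |x y. x \<in> lower_central G (Suc m) \<and> y \<in> carrier G}"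
    proof
      fix c assume "c \<in> {HG.comm x y |x y. x \<in> lower_central (G\<lparr>carrier := H\<rparr>) (Suc m) \<and> y \<in> H}"
      then obtain x y where xy: "c = HG.comm x y" "x \<in> lower_central (G\<lparr>carrier := H\<rparr>) (Suc m)" "y \<in> H"
        by blast
      then have "x \<in> H" using HG.lower_central_subset by auto
      then have "c = comm x y"
        using xy m_inv_consistent[OF assms] by simp
      then show "c \<in> {comm x y |x y. x \<in> lower_central G (Suc m) \<and> y \<in> carrier G}"
        using subsetD[OF Suc xy(2)] subsetD[OF H.subset xy(3)] by blast
    qed
    have inH: "{HG.comm x y |x y. x \<in> lower_central (G\<lparr>carrier := H\<rparr>) (Suc m) \<and> y \<in> H} \<subseteq> H"
    proof
      fix c assume "c \<in> {HG.comm x y |x y. x \<in> lower_central (G\<lparr>carrier := H\<rparr>) (Suc m) \<and> y \<in> H}"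
      then obtain x y where xy: "c = HG.comm x y" "x \<in> lower_central (G\<lparr>carrier := H\<rparr>) (Suc m)"
        "y \<in> carrier (G\<lparr>carrier := H\<rparr>)" by auto
      have "c \<in> carrier (G\<lparr>carrier := H\<rparr>)"
        unfolding xy(1) using HG.lower_central_carrier[OF xy(2)] xy(3) by (intro HG.m_closed HG.inv_closed)
      then show "c \<in> H" by simp
    qed
    show ?case
      using generate_consistent[OF inH assms] mono_generate[OF sub] by simp
  qed
  then show ?thesis by (cases n) auto
qed

text \<open>The quotient by \<open>N\<close> makes the generated subgroup abelian, and in an abelian group the elements with
trivial \<open>n\<close>-th power form a subgroup.\<close>
lemma generate_power_mod:
  assumes N: "N \<lhd> G" and A: "A \<subseteq> carrier G" and pow: "\<And>a. a \<in> A \<Longrightarrow> a [^] (n::nat) \<in> N"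
    and comm: "\<And>a b. a \<in> generate G A \<Longrightarrow> b \<in> generate G A \<Longrightarrow> comm a b \<in> N"
    and z: "z \<in> generate G A"
  shows "z [^] n \<in> N"
proof -
  interpret N: normal N G by (rule N)
  obtain Q :: "'a set monoid" and \<phi> where \<phi>: "group_hom G Q \<phi>"
    and mem: "\<And>a. a \<in> carrier G \<Longrightarrow> a \<in> N \<longleftrightarrow> \<phi> a = \<one>\<^bsub>Q\<^esub>"
    using normal_is_kernel[OF N] by metis
  interpret h: group_hom G Q \<phi> by (rule \<phi>)
  show ?thesis
    using z
  proof (induction rule: generate.induct)
    case (inv a)
    then show ?case using A pow[of a] by (auto simp: nat_pow_inv subset_iff)
  next
    case (eng a b)
    then have ab: "a \<in> carrier G" "b \<in> carrier G" using generate_in_carrier[OF A] by auto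
    have "h.H.comm (\<phi> a) (\<phi> b) = \<one>\<^bsub>Q\<^esub>"
      using comm[OF eng.hyps] mem[of "comm a b"] ab by simp
    then have "\<phi> a \<otimes>\<^bsub>Q\<^esub> \<phi> b = \<phi> b \<otimes>\<^bsub>Q\<^esub> \<phi> a"
      using ab by (subst (asm) h.H.comm_eq_one_iff) auto
    then have "\<phi> ((a \<otimes> b) [^] n) = \<phi> a [^]\<^bsub>Q\<^esub> n \<otimes>\<^bsub>Q\<^esub> \<phi> b [^]\<^bsub>Q\<^esub> n"
      using ab h.H.pow_mult_distrib[of "\<phi> a" "\<phi> b" n] by (simp add: h.hom_nat_pow)
    also have "\<dots> = \<one>\<^bsub>Q\<^esub>"
      using eng.IH mem[of "a [^] n"] mem[of "b [^] n"] ab by (simp add: h.hom_nat_pow)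
    finally show ?case using mem[of "(a \<otimes> b) [^] n"] ab by simp
  qed (use pow in auto)
qed

text \<open>Let \<open>a \<in> \<gamma>\<^sub>k\<close> with \<open>a\<^sup>n \<in> \<gamma>\<^bsub>k+1\<^esub>\<close>. Modulo \<open>\<gamma>\<^bsub>k+2\<^esub>\<close>, the power \<open>[a, h]\<^sup>n\<close> agrees with \<open>[a\<^sup>n, h]\<close>, which
is trivial there. So the property passes from the generators in one term to those in the next.\<close>
lemma lower_central_power:
  assumes S: "S \<subseteq> carrier G" and gen: "generate G S = carrier G"
    and pow: "\<And>s. s \<in> S \<Longrightarrow> s [^] (n::nat) = \<one>"
  shows "z \<in> lower_central G (Suc k) \<Longrightarrow> z [^] n \<in> lower_central G (Suc (Suc k))"
proof (induction k arbitrary: z)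
  case 0
  show ?case
  proof (rule generate_power_mod[OF lower_central_normal S])
    show "s [^] n \<in> lower_central G (Suc (Suc 0))" if "s \<in> S" for s
      using pow[OF that] by (simp add: generate.one)
    show "comm a b \<in> lower_central G (Suc (Suc 0))" if "a \<in> generate G S" "b \<in> generate G S" for a b
      using that gen by (intro comm_lower_central) auto
    show "z \<in> generate G S" using 0 gen by simp
  qed
next
  case (Suc k)
  let ?A = "{comm x y |x y. x \<in> lower_central G (Suc k) \<and> y \<in> carrier G}"
  have A: "?A \<subseteq> carrier G" by (auto dest: lower_central_carrier)
  have lc: "generate G ?A = lower_central G (Suc (Suc k))" by simp
  show ?case
  proof (rule generate_power_mod[OF lower_central_normal A])
    fix a assume "a \<in> ?A"
    then obtain x y where xy: "a = comm x y" "x \<in> lower_central G (Suc k)" "y \<in> carrier G" by blast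
    have x: "x \<in> carrier G" using xy lower_central_subset by blast
    have "comm (comm x y) h \<in> lower_central G (Suc (Suc (Suc k)))" if "h \<in> carrier G" for h
      using xy that by (intro comm_lower_central)
    then have "comm (x [^] n) (y [^] (1::nat)) \<in> lower_central G (Suc (Suc (Suc k))) \<longleftrightarrow>
        comm x y [^] (n * 1) \<in> lower_central G (Suc (Suc (Suc k)))"
      using x xy by (intro comm_power_mod lower_central_normal)
    moreover have "comm (x [^] n) (y [^] (1::nat)) \<in> lower_central G (Suc (Suc (Suc k)))"
      using Suc.IH xy by (intro comm_lower_central) auto
    ultimately show "a [^] n \<in> lower_central G (Suc (Suc (Suc k)))"
      using xy by simp
  next
    fix a b assume "a \<in> generate G ?A" "b \<in> generate G ?A"
    then show "comm a b \<in> lower_central G (Suc (Suc (Suc k)))"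
      unfolding lc using lower_central_subset by (intro comm_lower_central) blast+
  next
    show "z \<in> generate G ?A" unfolding lc by (rule Suc.prems)
  qed
qed

lemma generated_nilpotent_exponent:
  assumes "S \<subseteq> carrier G" "generate G S = carrier G" "\<And>s. s \<in> S \<Longrightarrow> s [^] (n::nat) = \<one>"
    and c: "lower_central G (Suc c) = {\<one>}" and z: "z \<in> carrier G"
  shows "z [^] (n ^ c) = \<one>"
proof -
  have "z [^] (n ^ k) \<in> lower_central G (Suc k)" for k
  proof (induction k)
    case 0
    then show ?case using z by simp
  next
    case (Suc k)
    have "z [^] (n ^ Suc k) = (z [^] (n ^ k)) [^] n" using z by (simp add: nat_pow_pow mult.commute)
    then show ?case using lower_central_power[OF assms(1-3) Suc] by simp
  qed
  from this[of c] show ?thesis using c by simp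
qed

text \<open>Two torsion elements generate a nilpotent group to which \<open>generated_nilpotent_exponent\<close> applies with a
common exponent of the generators.\<close>
lemma torsion_part_subgroup:
  assumes c: "lower_central G (Suc c) = {\<one>}"
  shows "subgroup (torsion_part G) G"
proof (rule subgroupI)
  show "torsion_part G \<noteq> {}" by (auto simp: torsion_part_def intro!: exI[of _ \<one>] exI[of _ 1])
  show "inv a \<in> torsion_part G" if "a \<in> torsion_part G" for a
    using that by (auto simp: torsion_part_def nat_pow_inv)
next
  fix x y assume "x \<in> torsion_part G" "y \<in> torsion_part G"
  then obtain m n :: nat where xy: "x \<in> carrier G" "y \<in> carrier G" "m > 0" "n > 0" "x [^] m = \<one>" "y [^] n = \<one>"
    by (auto simp: torsion_part_def)
  define H where "H = generate G {x, y}"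
  have S: "{x, y} \<subseteq> carrier G" using xy by simp
  have H: "subgroup H G" unfolding H_def by (rule generate_is_subgroup[OF S])
  interpret HG: group "G\<lparr>carrier := H\<rparr>" using subgroup_imp_group[OF H] .
  have xyH: "x \<in> H" "y \<in> H" by (simp_all add: H_def generate.incl)
  have consistent: "a [^]\<^bsub>G\<lparr>carrier := H\<rparr>\<^esub> k = a [^] k" for a and k :: nat
    using nat_pow_consistent[of a k H] by simp
  have "x \<otimes> y \<in> H" using H xyH by (rule subgroup.m_closed)
  have "(x \<otimes> y) [^]\<^bsub>G\<lparr>carrier := H\<rparr>\<^esub> ((m * n) ^ c) = \<one>\<^bsub>G\<lparr>carrier := H\<rparr>\<^esub>"
  proof (rule HG.generated_nilpotent_exponent[of "{x, y}"])
    show "{x, y} \<subseteq> carrier (G\<lparr>carrier := H\<rparr>)" using xyH by simp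
    show "generate (G\<lparr>carrier := H\<rparr>) {x, y} = carrier (G\<lparr>carrier := H\<rparr>)"
      using generate_consistent[of "{x, y}" H] xyH H by (simp add: H_def)
    have "x [^] (m * n) = \<one>" "y [^] (m * n) = \<one>"
      using xy by (metis nat_pow_one nat_pow_pow, metis mult.commute nat_pow_one nat_pow_pow)
    then show "s [^]\<^bsub>G\<lparr>carrier := H\<rparr>\<^esub> (m * n) = \<one>\<^bsub>G\<lparr>carrier := H\<rparr>\<^esub>" if "s \<in> {x, y}" for s
      using that by (auto simp: consistent)
    show "lower_central (G\<lparr>carrier := H\<rparr>) (Suc c) = {\<one>\<^bsub>G\<lparr>carrier := H\<rparr>\<^esub>}"
      using lower_central_subgroup_mono[OF H, of "Suc c"] c
        subgroup.one_closed[OF normal_imp_subgroup[OF HG.lower_central_normal[of "Suc c"]]] by auto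
    show "x \<otimes> y \<in> carrier (G\<lparr>carrier := H\<rparr>)" using \<open>x \<otimes> y \<in> H\<close> by simp
  qed
  then have "(x \<otimes> y) [^] ((m * n) ^ c) = \<one>" by (simp add: consistent)
  moreover have "(m * n) ^ c > 0" using xy by simp
  ultimately show "x \<otimes> y \<in> torsion_part G"
    using xy unfolding torsion_part_def by blast
qed (auto simp: torsion_part_def)

text \<open>Let \<open>z = [u, w]\<close> for \<open>p\<^sup>a\<close>-th powers \<open>u\<close>, \<open>w\<close> of \<open>x\<close>, \<open>y\<close>, where \<open>z\<close> already lies so deep that it is
central modulo a term \<open>N\<close> of the series. The commutator of \<open>w\<close> with \<open>u\<close> raised to \<open>p\<^bsup>2b\<^esup>\<close> is trivial by
assumption, so \<open>z\<close> raised to \<open>p\<^bsup>2b\<^esup>\<close> lies in \<open>N\<close>; modulo \<open>N\<close>, this is also the commutator of the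
\<open>p\<^sup>b\<close>-th powers of \<open>u\<close> and \<open>w\<close>. Each step down the series therefore costs half of the remaining
exponent, which explains the exponent \<open>2\<^sup>k b\<close>.\<close>
lemma comm_deep_powers:
  fixes p :: nat
  assumes "x \<in> carrier G" "y \<in> carrier G"
    and "x [^] (p ^ (2 ^ k * b)) \<otimes> y = y \<otimes> x [^] (p ^ (2 ^ k * b))"
  shows "comm (x [^] (p ^ ((2 ^ k - 1) * b))) (y [^] (p ^ ((2 ^ k - 1) * b))) \<in> lower_central G (Suc (Suc k))"
  using assms
proof (induction k arbitrary: b)
  case 0
  then have "comm x y \<in> lower_central G (Suc (Suc 0))"
    by (intro comm_lower_central) simp_all
  then show ?case using 0(1,2) by simp
next
  case (Suc k)
  define a where "a = (2 ^ k - 1) * (2 * b)"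
  define u w where "u = x [^] (p ^ a)" and "w = y [^] (p ^ a)"
  define N where "N = lower_central G (Suc (Suc (Suc k)))"
  have u: "u \<in> carrier G" and w: "w \<in> carrier G" using Suc.prems by (simp_all add: u_def w_def)
  have z: "comm u w \<in> lower_central G (Suc (Suc k))"
    unfolding u_def w_def a_def using Suc.prems by (intro Suc.IH) (simp_all add: mult_ac)
  have iff: "comm (u [^] r) (w [^] s) \<in> N \<longleftrightarrow> comm u w [^] (r * s) \<in> N" for r s :: nat
    unfolding N_def by (rule comm_power_mod[OF lower_central_normal u w comm_lower_central[OF z]])
  have e: "a + 2 * b = 2 ^ Suc k * b" "a + b = (2 ^ Suc k - 1) * b"
  proof -
    obtain j where "(2::nat) ^ k = Suc j" by (metis not0_implies_Suc power_not_zero zero_neq_numeral)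
    then show "a + 2 * b = 2 ^ Suc k * b" "a + b = (2 ^ Suc k - 1) * b" by (simp_all add: a_def algebra_simps)
  qed
  have "u [^] (p ^ (2 * b)) = x [^] (p ^ (2 ^ Suc k * b))"
    using Suc.prems(1) by (simp add: u_def nat_pow_pow e(1) flip: power_add)
  then have "u [^] (p ^ (2 * b)) \<otimes> y = y \<otimes> u [^] (p ^ (2 * b))"
    using Suc.prems(3) by simp
  then have "u [^] (p ^ (2 * b)) \<otimes> w = w \<otimes> u [^] (p ^ (2 * b))"
    unfolding w_def using group_commutes_pow[of y "u [^] (p ^ (2 * b))"] u Suc.prems(2) by simp
  then have "comm (u [^] (p ^ (2 * b))) w = \<one>"
    using comm_eq_one_iff[OF nat_pow_closed[OF u] w] by blast
  then have "comm (u [^] (p ^ (2 * b))) (w [^] (1::nat)) = \<one>"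
    unfolding nat_pow_eone[OF w] .
  moreover have "\<one> \<in> N"
    unfolding N_def using subgroup.one_closed[OF normal_imp_subgroup[OF lower_central_normal]] .
  ultimately have "comm u w [^] (p ^ (2 * b)) \<in> N"
    using iff[of "p ^ (2 * b)" 1] by simp
  then have "comm (u [^] (p ^ b)) (w [^] (p ^ b)) \<in> N"
    using iff by (simp add: mult_2 flip: power_add)
  moreover have "u [^] (p ^ b) = x [^] (p ^ ((2 ^ Suc k - 1) * b))" "w [^] (p ^ b) = y [^] (p ^ ((2 ^ Suc k - 1) * b))"
    using Suc.prems by (simp_all add: u_def w_def nat_pow_pow e(2) flip: power_add)
  ultimately show ?case by (simp add: N_def)
qed

end

section \<open>The torsion subgroup\<close>

lemma prime_power_le_four_dvd:
  assumes "Factorial_Ring.prime p" "p ^ k \<le> (4::nat)"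
  shows "p ^ k dvd (if p = 3 then 3 else 4)"
proof -
  have "p \<ge> 2" using assms(1) prime_ge_2_nat by blast
  consider "k = 0" | "k = 1" | "k \<ge> 2" by linarith
  then show ?thesis
  proof cases
    case 2
    then have "p \<in> {2, 3, 4}" using assms(2) \<open>p \<ge> 2\<close> by auto
    then show ?thesis using 2 by auto
  next
    case 3
    have "p ^ 2 \<le> p ^ k" using 3 \<open>p \<ge> 2\<close> by (intro power_increasing) auto
    then have le: "p ^ 2 \<le> 4" using assms(2) by simp
    have "p = 2"
    proof (rule ccontr)
      assume "p \<noteq> 2"
      then have "3 ^ 2 \<le> p ^ 2" using \<open>p \<ge> 2\<close> by (intro power_mono) auto
      then show False using le by simp
    qed
    have "k < 3"
    proof (rule ccontr)
      assume "\<not> k < 3"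
      then have "(2::nat) ^ 3 \<le> 2 ^ k" by (intro power_increasing) auto
      then show False using assms(2) \<open>p = 2\<close> by simp
    qed
    then have "k = 2" using 3 by simp
    then show ?thesis using \<open>p = 2\<close> by simp
  qed simp
qed

lemma exists_exponent_le:
  assumes "m > 0" "\<And>x. x \<in> carrier H \<Longrightarrow> x [^]\<^bsub>H\<^esub> m = \<one>\<^bsub>H\<^esub>"
  shows "\<exists>e\<le>m. has_exponent H (e::nat)"
proof -
  let ?P = "\<lambda>e::nat. e > 0 \<and> (\<forall>x\<in>carrier H. x [^]\<^bsub>H\<^esub> e = \<one>\<^bsub>H\<^esub>)"
  have "?P m" using assms by simp
  then have "?P (LEAST e. ?P e)" "(LEAST e. ?P e) \<le> m"
    using LeastI[of ?P m] Least_le[of ?P m] by blast+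
  moreover have "\<forall>n>0. (\<forall>x\<in>carrier H. x [^]\<^bsub>H\<^esub> n = \<one>\<^bsub>H\<^esub>) \<longrightarrow> (LEAST e. ?P e) \<le> n"
    by (auto intro: Least_le)
  ultimately show ?thesis
    unfolding has_exponent_def by blast
qed

context group
begin

lemma ord_subgroup:
  assumes H: "subgroup H G" and "x \<in> H"
  shows "group.ord (G\<lparr>carrier := H\<rparr>) x = ord x"
proof -
  interpret HG: group "G\<lparr>carrier := H\<rparr>" using subgroup_imp_group[OF H] .
  have "x \<in> carrier G" using assms subgroup.subset by blast
  then show ?thesis
    using assms(2) by (subst HG.ord_unique) (auto simp: pow_eq_id simp flip: nat_pow_consistent)
qed

text \<open>In a nilpotent group the factor from a late term of the series is \<open>1\<close>, and infinite height means having
all \<open>p\<^sup>i\<close>-th roots.\<close>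
lemma infinite_height_eq_roots:
  assumes c: "lower_central G (Suc c) = {\<one>}"
  shows "infinite_height G p = {g \<in> carrier G. \<forall>i. \<exists>x\<in>carrier G. x [^] (p ^ i) = g}"
proof (intro equalityI subsetI)
  fix g assume g: "g \<in> infinite_height G p"
  then have gc: "g \<in> carrier G" by (simp add: infinite_height_def)
  have "\<exists>x\<in>carrier G. x [^] (p ^ i) = g" for i
  proof -
    have "\<exists>x\<in>carrier G. \<exists>y\<in>lower_central G (Suc c). x [^] (p ^ i) = g \<otimes> y"
      using g le_add1[of 1 c] unfolding infinite_height_def by auto
    then show ?thesis unfolding c using gc by simp
  qed
  with gc show "g \<in> {g \<in> carrier G. \<forall>i. \<exists>x\<in>carrier G. x [^] (p ^ i) = g}" by simp
next
  fix g assume g: "g \<in> {g \<in> carrier G. \<forall>i. \<exists>x\<in>carrier G. x [^] (p ^ i) = g}"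
  have "\<exists>x\<in>carrier G. \<exists>y\<in>lower_central G j. x [^] (p ^ i) = g \<otimes> y" for i j
  proof -
    obtain x where x: "x \<in> carrier G" "x [^] (p ^ i) = g" using g by blast
    have "\<one> \<in> lower_central G j"
      using normal_imp_subgroup[OF lower_central_normal] by (rule subgroup.one_closed)
    moreover have "x [^] (p ^ i) = g \<otimes> \<one>" using x g by simp
    ultimately show ?thesis using x(1) by blast
  qed
  with g show "g \<in> infinite_height G p" unfolding infinite_height_def by blast
qed

text \<open>To find a root of a product \<open>gh\<close>, choose much deeper roots \<open>x\<close>, \<open>y\<close> of the factors; since \<open>g\<close> is
central, suitable powers \<open>u\<close>, \<open>w\<close> of them commute by \<open>comm_deep_powers\<close>, and \<open>uw\<close> is a root of \<open>gh\<close>.\<close>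
lemma infinite_height_subgroup:
  assumes c: "lower_central G (Suc c) = {\<one>}"
    and central: "\<And>g h. g \<in> infinite_height G p \<Longrightarrow> h \<in> carrier G \<Longrightarrow> g \<otimes> h = h \<otimes> g"
  shows "subgroup (infinite_height G p) G"
proof (rule subgroupI)
  note roots = infinite_height_eq_roots[OF c, of p]
  show "infinite_height G p \<noteq> {}"
    unfolding roots by (auto intro!: exI[of _ \<one>] bexI[of _ \<one>])
  show "inv a \<in> infinite_height G p" if "a \<in> infinite_height G p" for a
  proof -
    have "\<exists>x\<in>carrier G. x [^] (p ^ i) = inv a" for i
    proof -
      obtain x where "x \<in> carrier G" "x [^] (p ^ i) = a" using \<open>a \<in> infinite_height G p\<close> unfolding roots by auto
      then show ?thesis by (intro bexI[of _ "inv x"]) (auto simp: nat_pow_inv)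
    qed
    then show ?thesis using that unfolding roots by simp
  qed
  fix g h assume g: "g \<in> infinite_height G p" and h: "h \<in> infinite_height G p"
  have gh: "g \<in> carrier G" "h \<in> carrier G" using g h by (simp_all add: infinite_height_def)
  have "\<exists>x\<in>carrier G. x [^] (p ^ i) = g \<otimes> h" for i
  proof -
    obtain x y where x: "x \<in> carrier G" "x [^] (p ^ (2 ^ c * i)) = g"
      and y: "y \<in> carrier G" "y [^] (p ^ (2 ^ c * i)) = h"
      using g h unfolding roots by (auto; blast)
    define a where "a = (2 ^ c - 1) * i"
    have a: "a + i = 2 ^ c * i" by (simp add: a_def algebra_simps)
    define u w where "u = x [^] (p ^ a)" and "w = y [^] (p ^ a)"
    have uw: "u \<in> carrier G" "w \<in> carrier G" using x y by (simp_all add: u_def w_def)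
    have "comm u w \<in> lower_central G (Suc (Suc c))"
      unfolding u_def w_def a_def using central[OF g y(1)] x y by (intro comm_deep_powers) simp_all
    then have "comm u w = \<one>"
      using lower_central_trivial_mono[OF c, of 1] by (simp del: lower_central.simps)
    then have "u \<otimes> w = w \<otimes> u" using comm_eq_one_iff uw by blast
    then have "(u \<otimes> w) [^] (p ^ i) = u [^] (p ^ i) \<otimes> w [^] (p ^ i)"
      using uw by (rule pow_mult_distrib)
    also have "\<dots> = g \<otimes> h"
      using x y by (simp add: u_def w_def nat_pow_pow a flip: power_add)
    finally show ?thesis using uw by blast
  qed
  then show "g \<otimes> h \<in> infinite_height G p" using gh unfolding roots by simp
qed (simp add: infinite_height_def subset_iff)

lemma coprime_orders_two_three:
  assumes triv: "units_omega G = {\<one>\<^bsub>group_ring G\<^esub>}"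
    and g: "g \<in> carrier G" and h: "h \<in> carrier G" and cop: "coprime (ord g) (ord h)"
    and gt: "ord g > 1" "ord h > 1"
  shows "ord g = 2 \<and> ord h = 3 \<or> ord g = 3 \<and> ord h = 2"
proof -
  have two: "ord b = 3" if "a \<in> carrier G" "b \<in> carrier G" "coprime (ord a) (ord b)" "ord a = 2" "ord b > 1" for a b
  proof -
    have "odd (ord b)" using that by simp
    moreover from this have "\<not> ord b \<ge> 5" using order_two_coprime_order[OF triv that(1,2,4)] by blast
    ultimately show ?thesis using that(5) by presburger
  qed
  have "ord g = 2 \<or> ord g > 2" "ord h = 2 \<or> ord h > 2"
    using gt by linarith+
  then have "ord g = 2 \<or> ord h = 2"
    using coprime_orders_gt_two[OF triv g h cop] by blast
  then show ?thesis using two[OF g h] two[OF h g] cop gt by (auto simp: coprime_commute)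
qed

lemma element_of_order:
  assumes "x \<in> carrier G" "ord x > 0" "d dvd ord x"
  shows "ord (x [^] (ord x div d)) = d"
proof -
  obtain k where k: "ord x = d * k" using assms(3) by (elim dvdE)
  then have "d > 0" "k > 0" using assms(2) by auto
  then have "ord x div d = k" using k by simp
  then show ?thesis using ord_pow[OF assms(1), of k] k \<open>k > 0\<close> by simp
qed

lemma torsion_part_ord: "x \<in> torsion_part G \<longleftrightarrow> x \<in> carrier G \<and> ord x > 0"
  by (auto simp: torsion_part_def pow_eq_id intro: Nat.gr0I)

text \<open>Elements of coprime prime orders exist and must have orders \<open>2\<close> and \<open>3\<close>; call them \<open>a\<close>, \<open>b\<close>. Every
odd divisor \<open>d > 1\<close> of the order of a torsion element is then \<open>3\<close> by comparison with \<open>a\<close>, and every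
divisor prime to \<open>3\<close> is \<open>1\<close> or \<open>2\<close> by comparison with \<open>b\<close>.\<close>
lemma non_primary_torsion:
  assumes triv: "units_omega G = {\<one>\<^bsub>group_ring G\<^esub>}"
    and nontriv: "torsion_part G \<noteq> {\<one>}"
    and nonprim: "\<And>p. Factorial_Ring.prime p \<Longrightarrow> \<exists>x\<in>torsion_part G. \<forall>k. ord x \<noteq> p ^ k"
  obtains a b where "a \<in> torsion_part G" "b \<in> torsion_part G" "ord a = 2" "ord b = 3"
    "\<And>x. x \<in> torsion_part G \<Longrightarrow> ord x \<in> {1, 2, 3, 6}"
proof -
  have "\<one> \<in> torsion_part G" by (simp add: torsion_part_ord)
  then obtain t where t: "t \<in> carrier G" "ord t > 0" "t \<noteq> \<one>"
    using nontriv torsion_part_ord by blast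
  then have "ord t \<noteq> 1" using ord_eq_1 by blast
  then obtain p where p: "Factorial_Ring.prime p" "p dvd ord t" using prime_factor_nat by blast
  obtain s where s: "s \<in> carrier G" "ord s > 0" "\<And>k. ord s \<noteq> p ^ k"
    using nonprim[OF p(1)] torsion_part_ord by blast
  obtain n where n: "ord s = p ^ multiplicity p (ord s) * n" "\<not> p dvd n"
    using multiplicity_decompose'[of "ord s" p] s(2) p(1) by (metis gr_implies_not0 not_prime_unit)
  have "n \<noteq> 1" using n(1) s(3) by (metis mult.right_neutral)
  then obtain q where q: "Factorial_Ring.prime q" "q dvd n" using prime_factor_nat by blast
  then have "q dvd ord s" using n(1) by (metis dvd_mult)
  have "coprime p q" using p(1) q n(2) by (metis primes_coprime)
  define g h where "g = t [^] (ord t div p)" and "h = s [^] (ord s div q)"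
  have g: "g \<in> carrier G" "ord g = p" using element_of_order[OF t(1,2) p(2)] t by (simp_all add: g_def)
  have h: "h \<in> carrier G" "ord h = q" using element_of_order[OF s(1,2) \<open>q dvd ord s\<close>] s by (simp_all add: h_def)
  have "p > 1" "q > 1" using p q prime_gt_1_nat by auto
  then have "p = 2 \<and> q = 3 \<or> p = 3 \<and> q = 2"
    using coprime_orders_two_three[OF triv g(1) h(1)] g(2) h(2) \<open>coprime p q\<close> by simp
  then obtain a b where ab: "a \<in> carrier G" "b \<in> carrier G" "ord a = 2" "ord b = 3"
    using g h by metis
  have "ord x \<in> {1, 2, 3, 6}" if "x \<in> torsion_part G" for x
  proof -
    have x: "x \<in> carrier G" "ord x > 0" using that torsion_part_ord by auto
    have odd_part: "d = 3" if "d dvd ord x" "coprime 2 d" "d > 1" for d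
      using coprime_orders_two_three[OF triv ab(1), of "x [^] (ord x div d)"] ab that x
        element_of_order[OF x that(1)] by simp
    have three_part: "d = 2" if "d dvd ord x" "coprime 3 d" "d > 1" for d
      using coprime_orders_two_three[OF triv ab(2), of "x [^] (ord x div d)"] ab that x
        element_of_order[OF x that(1)] by simp
    obtain m where m: "ord x = 2 ^ multiplicity 2 (ord x) * m" "\<not> 2 dvd m"
      using multiplicity_decompose'[of "ord x" 2] x(2) by auto
    have "coprime 2 m" using m(2) by simp
    then have "m = 1 \<or> m = 3" using odd_part[of m] m x by (metis dvd_triv_right gr0I less_one nat_neq_iff mult_0_right)
    moreover have "2 ^ multiplicity 2 (ord x) = (1::nat) \<or> 2 ^ multiplicity 2 (ord x) = (2::nat)"
    proof (cases "multiplicity 2 (ord x) = 0")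
      case False
      then have "(2::nat) ^ multiplicity 2 (ord x) > 1"
        using one_less_power[of "2::nat" "multiplicity 2 (ord x)"] by simp
      moreover have "coprime 3 ((2::nat) ^ multiplicity 2 (ord x))" by simp
      ultimately show ?thesis using three_part[of "2 ^ multiplicity 2 (ord x)"] multiplicity_dvd by blast
    qed simp
    ultimately show ?thesis using m(1) by auto
  qed
  moreover have "a \<in> torsion_part G" "b \<in> torsion_part G" using ab by (simp_all add: torsion_part_ord)
  ultimately show ?thesis using that ab by blast
qed

text \<open>If the order of \<open>h\<close> is \<open>N = p\<^sup>m\<close>, then \<open>N\<^sup>i\<close>-th roots are \<open>p\<^bsup>mi\<^esup>\<close>-th roots.\<close>
lemma infinite_height_omega_pair:
  assumes c: "lower_central G (Suc c) = {\<one>}"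
    and p: "\<forall>x\<in>torsion_part G. \<exists>k. ord x = p ^ k"
    and g: "g \<in> infinite_height (G\<lparr>carrier := torsion_part G\<rparr>) p" and h: "h \<in> torsion_part G"
  shows "omega_pair g h"
proof -
  have T: "subgroup (torsion_part G) G" by (rule torsion_part_subgroup[OF c])
  interpret T: group "G\<lparr>carrier := torsion_part G\<rparr>" using subgroup_imp_group[OF T] .
  have cT: "lower_central (G\<lparr>carrier := torsion_part G\<rparr>) (Suc c) = {\<one>\<^bsub>G\<lparr>carrier := torsion_part G\<rparr>\<^esub>}"
    using lower_central_subgroup_mono[OF T, of "Suc c"] c
      subgroup.one_closed[OF normal_imp_subgroup[OF T.lower_central_normal[of "Suc c"]]] by auto
  obtain m where m: "ord h = p ^ m" using p h by blast
  have hc: "h \<in> carrier G" using h torsion_part_ord by blast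
  show ?thesis
  proof (rule omega_pairI[OF hc pow_ord_eq_1[OF hc]])
    fix i
    have "\<exists>x\<in>torsion_part G. x [^] (p ^ (m * i)) = g"
      using g unfolding T.infinite_height_eq_roots[OF cT] by (simp flip: nat_pow_consistent)
    then show "\<exists>x\<in>carrier G. x [^] (ord h ^ i) = g"
      unfolding m power_mult[symmetric] using torsion_part_ord by blast
  qed
qed

text \<open>Elements of \<open>T(p)\<close> form omega pairs with all of \<open>T\<close>, in particular with themselves. If \<open>T(p) = T\<close>, then
the orders are at most \<open>4\<close>, so \<open>p\<^sup>2\<close> annihilates \<open>T\<close>, whereas every element is a \<open>p\<^sup>2\<close>-th power.\<close>
lemma primary_torsion:
  assumes triv: "units_omega G = {\<one>\<^bsub>group_ring G\<^esub>}"
    and c: "lower_central G (Suc c) = {\<one>}"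
    and nontriv: "torsion_part G \<noteq> {\<one>}"
    and prime: "Factorial_Ring.prime p"
    and p: "\<forall>x\<in>torsion_part G. \<exists>k. ord x = p ^ k"
  defines "T \<equiv> G\<lparr>carrier := torsion_part G\<rparr>"
  shows "infinite_height T p \<noteq> carrier T"
    and "subgroup (infinite_height T p) G"
    and "infinite_height T p \<subseteq> torsion_part G"
    and "\<And>x y. x \<in> infinite_height T p \<Longrightarrow> y \<in> torsion_part G \<Longrightarrow> x \<otimes> y = y \<otimes> x"
    and "\<And>x. x \<in> infinite_height T p \<Longrightarrow> ord x \<le> 4"
proof -
  have T: "subgroup (torsion_part G) G" by (rule torsion_part_subgroup[OF c])
  interpret T: group T unfolding T_def using subgroup_imp_group[OF T] .
  have cT: "lower_central T (Suc c) = {\<one>\<^bsub>T\<^esub>}"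
    using lower_central_subgroup_mono[OF T, of "Suc c"] c
      subgroup.one_closed[OF normal_imp_subgroup[OF T.lower_central_normal[of "Suc c"]]]
    unfolding T_def by auto
  show sub: "infinite_height T p \<subseteq> torsion_part G"
    by (auto simp: infinite_height_def T_def)
  note pair = infinite_height_omega_pair[OF c p, folded T_def]
  show central: "x \<otimes> y = y \<otimes> x" if "x \<in> infinite_height T p" "y \<in> torsion_part G" for x y
    using omega_pair_commute[OF triv _ _ pair[OF that]] that sub torsion_part_ord by blast
  show bound: "ord x \<le> 4" if "x \<in> infinite_height T p" for x
  proof -
    have "x \<in> torsion_part G" using that sub by blast
    then obtain k where "ord x = p ^ k" using p by blast
    then show ?thesis
      using prime_power_omega_pair_self[OF triv _ pair[OF that \<open>x \<in> torsion_part G\<close>] prime]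
        \<open>x \<in> torsion_part G\<close> torsion_part_ord by blast
  qed
  have "subgroup (infinite_height T p) T"
    using central by (intro T.infinite_height_subgroup[OF cT]) (simp add: T_def)
  then show "subgroup (infinite_height T p) G"
    unfolding T_def by (rule incl_subgroup[OF T])
  show "infinite_height T p \<noteq> carrier T"
  proof
    assume eq: "infinite_height T p = carrier T"
    have "\<one> \<in> torsion_part G" by (simp add: torsion_part_ord)
    then obtain t where t: "t \<in> torsion_part G" "t \<noteq> \<one>" using nontriv by blast
    then have "t \<in> infinite_height T p" unfolding eq by (simp add: T_def)
    then obtain x where x: "x \<in> torsion_part G" "x [^] (p ^ 2) = t"
      unfolding T.infinite_height_eq_roots[OF cT] by (auto simp: T_def simp flip: nat_pow_consistent)
    obtain k where k: "ord x = p ^ k" using p x(1) by blast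
    have "p ^ k \<le> 4" using bound[of x] x(1) k unfolding eq by (simp add: T_def)
    have "k < 3"
    proof (rule ccontr)
      assume "\<not> k < 3"
      have "(2::nat) ^ 3 \<le> 2 ^ k" using \<open>\<not> k < 3\<close> by (intro power_increasing) auto
      also have "\<dots> \<le> p ^ k" using prime_ge_2_nat[OF prime] by (intro power_mono) auto
      finally show False using \<open>p ^ k \<le> 4\<close> by simp
    qed
    then have "ord x dvd p ^ 2" unfolding k by (intro le_imp_power_dvd) simp
    then have "t = \<one>" using x torsion_part_ord pow_eq_id by blast
    then show False using t(2) by blast
  qed
qed

text \<open>A nontrivial \<open>p\<close>-group contains an element of order \<open>p\<close>.\<close>
lemma primary_two_three_torsion_free:
  assumes "Factorial_Ring.prime p" "p = 2 \<or> p = 3"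
    and p: "\<forall>x\<in>torsion_part G. \<exists>k. ord x = p ^ k"
    and free: "\<And>x. x \<in> torsion_part G \<Longrightarrow> ord x \<noteq> 2 \<and> ord x \<noteq> 3"
  shows "torsion_part G = {\<one>}"
proof -
  have "x = \<one>" if x: "x \<in> torsion_part G" for x
  proof -
    have xc: "x \<in> carrier G" "ord x > 0" using x torsion_part_ord by auto
    obtain k where k: "ord x = p ^ k" using p x by blast
    have "k = 0"
    proof (rule ccontr)
      assume "k \<noteq> 0"
      then have "p dvd ord x" using k by simp
      then have "ord (x [^] (ord x div p)) = p" using element_of_order xc by blast
      moreover have "x [^] (ord x div p) \<in> torsion_part G"
        using calculation assms(2) xc by (auto simp: torsion_part_ord)
      ultimately show False using free assms(2) by blast
    qed
    then show ?thesis using k xc(1) ord_eq_1 by simp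
  qed
  moreover have "\<one> \<in> torsion_part G" by (simp add: torsion_part_ord)
  ultimately show ?thesis by blast
qed

end

theorem theorem7:
  fixes G (structure)
  assumes "nilpotent_group G"
  defines "T \<equiv> G\<lparr>carrier := torsion_part G\<rparr>"
  shows
    "(units_omega G = {\<one>\<^bsub>group_ring G\<^esub>} \<longrightarrow>
        carrier T = {\<one>} \<or>
        (two_three_group T \<and> has_exponent T 6) \<or>
        (\<exists>p. Factorial_Ring.prime p \<and> p_group p T \<and> infinite_height T p \<noteq> carrier T \<and>
           comm_group (T\<lparr>carrier := infinite_height T p\<rparr>) \<and>
           p_group p (T\<lparr>carrier := infinite_height T p\<rparr>) \<and>
           (\<exists>e\<le>4. has_exponent (T\<lparr>carrier := infinite_height T p\<rparr>) e))) \<and>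
     (two_three_torsion_free T \<longrightarrow> units_omega G = {\<one>\<^bsub>group_ring G\<^esub>} \<longrightarrow>
        torsion_free G \<or>
        (\<exists>p. Factorial_Ring.prime p \<and> p_group p T \<and> infinite_height T p = {\<one>}))"
proof -
  obtain c where "group G" and c: "lower_central G (Suc c) = {\<one>}"
    using assms(1) by (auto simp: nilpotent_group_def)
  interpret group G by (rule \<open>group G\<close>)
  have T: "subgroup (torsion_part G) G" by (rule torsion_part_subgroup[OF c])
  have ordT: "group.ord T x = ord x" if "x \<in> torsion_part G" for x
    unfolding T_def using ord_subgroup[OF T that] .
  have carT: "carrier T = torsion_part G" by (simp add: T_def)
  have powT: "x [^]\<^bsub>T\<^esub> (n::nat) = x [^] n" for x n
    unfolding T_def by (simp flip: nat_pow_consistent)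
  have oneT: "\<one>\<^bsub>T\<^esub> = \<one>" by (simp add: T_def)
  have carrier: "x \<in> carrier G" if "x \<in> torsion_part G" for x
    using that torsion_part_ord by blast
  let ?trivial = "units_omega G = {\<one>\<^bsub>group_ring G\<^esub>}"
  have primary: "infinite_height T p \<noteq> carrier T \<and>
      comm_group (T\<lparr>carrier := infinite_height T p\<rparr>) \<and>
      p_group p (T\<lparr>carrier := infinite_height T p\<rparr>) \<and>
      (\<exists>e\<le>4. has_exponent (T\<lparr>carrier := infinite_height T p\<rparr>) e) \<and>
      (p \<noteq> 2 \<and> p \<noteq> 3 \<longrightarrow> infinite_height T p = {\<one>})"
    if triv: ?trivial and nontriv: "carrier T \<noteq> {\<one>}" and prime: "Factorial_Ring.prime p" and "p_group p T" for p
  proof -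
    have p: "\<forall>x\<in>torsion_part G. \<exists>k. ord x = p ^ k"
      using \<open>p_group p T\<close> ordT by (simp add: p_group_def carT)
    note H = primary_torsion[OF triv c nontriv[unfolded carT] prime p, folded T_def]
    let ?I = "infinite_height T p"
    have upd: "T\<lparr>carrier := ?I\<rparr> = G\<lparr>carrier := ?I\<rparr>" by (simp add: T_def)
    have comm: "comm_group (G\<lparr>carrier := ?I\<rparr>)"
      using H(3,4) by (intro group.group_comm_groupI subgroup_imp_group[OF H(2)]) auto
    have dvd: "ord x dvd (if p = 3 then 3 else 4)" if "x \<in> ?I" for x
    proof -
      obtain k where "ord x = p ^ k" using bspec[OF p subsetD[OF H(3) \<open>x \<in> ?I\<close>]] by (elim exE)
      then show ?thesis using prime_power_le_four_dvd[OF prime, of k] H(5)[OF that] by simp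
    qed
    have "x [^] (if p = 3 then 3 else 4 :: nat) = \<one>" if "x \<in> ?I" for x
      unfolding pow_eq_id[OF carrier[OF subsetD[OF H(3) that]]] by (rule dvd[OF that])
    then have "\<exists>e\<le>(if p = 3 then 3 else 4). has_exponent (G\<lparr>carrier := ?I\<rparr>) e"
      by (intro exists_exponent_le) (simp_all flip: nat_pow_consistent)
    then obtain e :: nat where "e \<le> (if p = 3 then 3 else 4)" "has_exponent (G\<lparr>carrier := ?I\<rparr>) e"
      by blast
    moreover from this(1) have "e \<le> 4" by (simp split: if_splits)
    ultimately have "\<exists>e\<le>4. has_exponent (G\<lparr>carrier := ?I\<rparr>) e" by blast
    moreover have "p_group p (G\<lparr>carrier := ?I\<rparr>)"
      unfolding p_group_def using bspec[OF p subsetD[OF H(3)]] ord_subgroup[OF H(2)] by simp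
    moreover have "?I = {\<one>}" if "p \<noteq> 2" "p \<noteq> 3"
    proof -
      have "x = \<one>" if "x \<in> ?I" for x
      proof -
        obtain k where k: "ord x = p ^ k" using bspec[OF p subsetD[OF H(3) \<open>x \<in> ?I\<close>]] by (elim exE)
        have "p \<noteq> 4"
        proof
          assume "p = 4"
          then have "(2::nat) dvd p" by simp
          then show False using prime \<open>p \<noteq> 2\<close> primes_dvd_imp_eq two_is_prime_nat by blast
        qed
        then have "p \<ge> 5" using prime_ge_2_nat[OF prime] \<open>p \<noteq> 2\<close> \<open>p \<noteq> 3\<close> by linarith
        have "k = 0"
        proof (rule ccontr)
          assume "k \<noteq> 0"
          then have "p ^ 1 \<le> p ^ k" using \<open>p \<ge> 5\<close> by (intro power_increasing) auto
          then show False using H(5)[OF \<open>x \<in> ?I\<close>] k \<open>p \<ge> 5\<close> by simp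
        qed
        then have "ord x = 1" using k by simp
        then show ?thesis using ord_eq_1[OF carrier[OF subsetD[OF H(3) \<open>x \<in> ?I\<close>]]] by blast
      qed
      moreover have "\<one> \<in> ?I" using H(2) by (rule subgroup.one_closed)
      ultimately show ?thesis by blast
    qed
    ultimately show ?thesis using H(1) comm unfolding upd by blast
  qed
  have nonprimary: "two_three_group T \<and> has_exponent T 6 \<and> \<not> two_three_torsion_free T"
    if triv: ?trivial and nontriv: "carrier T \<noteq> {\<one>}" and "\<nexists>p. Factorial_Ring.prime p \<and> p_group p T"
  proof -
    have "\<exists>x\<in>torsion_part G. \<forall>k. ord x \<noteq> p ^ k" if "Factorial_Ring.prime p" for p
      using \<open>\<nexists>p. Factorial_Ring.prime p \<and> p_group p T\<close> that ordT by (auto simp: p_group_def carT)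
    then obtain a b where ab: "a \<in> torsion_part G" "b \<in> torsion_part G" "ord a = 2" "ord b = 3"
      and orders: "\<And>x. x \<in> torsion_part G \<Longrightarrow> ord x \<in> {1, 2, 3, 6}"
      using non_primary_torsion[OF triv nontriv[unfolded carT]] by metis
    have form: "\<exists>i j. n = 2 ^ i * 3 ^ j" if "n \<in> {1, 2, 3, 6}" for n :: nat
    proof -
      have "1 = 2 ^ 0 * (3::nat) ^ 0" "2 = 2 ^ 1 * (3::nat) ^ 0" "3 = 2 ^ 0 * (3::nat) ^ 1" "6 = 2 ^ 1 * (3::nat) ^ 1"
        by simp_all
      then show ?thesis using that by blast
    qed
    have "two_three_group T"
      unfolding two_three_group_def carT using form orders ordT by simp
    moreover have "has_exponent T 6"
      unfolding has_exponent_def carT powT oneT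
    proof (intro conjI ballI allI impI)
      fix x assume "x \<in> torsion_part G"
      then have "ord x dvd 6" using orders by fastforce
      then show "x [^] (6::nat) = \<one>" using pow_eq_id carrier[OF \<open>x \<in> torsion_part G\<close>] by blast
    next
      fix m :: nat assume "0 < m" and m: "\<forall>x\<in>torsion_part G. x [^] m = \<one>"
      then have "2 dvd m" "3 dvd m" using ab m pow_eq_id carrier by metis+
      then have "6 dvd m" using divides_mult[of 2 m 3] by simp
      then show "6 \<le> m" using \<open>0 < m\<close> by (rule dvd_imp_le)
    qed simp
    moreover have "\<not> two_three_torsion_free T"
      unfolding two_three_torsion_free_def carT using ab(1,3) ordT by auto
    ultimately show ?thesis by blast
  qed
  have small: "carrier T = {\<one>}"
    if "two_three_torsion_free T" "Factorial_Ring.prime p" "p = 2 \<or> p = 3" "p_group p T" for p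
    unfolding carT
  proof (rule primary_two_three_torsion_free[OF that(2,3)])
    show "\<forall>x\<in>torsion_part G. \<exists>k. ord x = p ^ k"
      using \<open>p_group p T\<close> ordT by (simp add: p_group_def carT)
    show "ord x \<noteq> 2 \<and> ord x \<noteq> 3" if "x \<in> torsion_part G" for x
      using \<open>two_three_torsion_free T\<close> that ordT[OF that] by (auto simp: two_three_torsion_free_def carT)
  qed
  have free: "torsion_free G \<longleftrightarrow> carrier T = {\<one>}" by (simp add: torsion_free_def carT)
  show ?thesis
    unfolding free using primary nonprimary small by blast
qed

end
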